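(* Let $\mathbf{k}$ be an algebraically closed field, let $k\ge2$, and let $\mathfrak{X}_k=\mathfrak{X}(F_k,\mathrm{SL}_2)$ be the $\mathrm{SL}_2$-character variety of the free group $F_k$ over $\mathbf{k}$. Write $t_A=\operatorname{tr}(A)$. Then $(A_1,\ldots,A_k)\in\mathfrak{X}_k$ is parametrized by the functions $$t_{A_i},\qquad t_{A_iA_j},\qquad t_{A_iA_jA_l},\qquad i<j<l$$ (that is, all of these functions with strictly increasing indices in $\{1,\ldots,k\}$ generate the coordinate ring $\mathcal{O}_{\mathfrak{X}_k}$). Moreover, the functions $$t_{A_1},\ t_{A_2},\ t_{A_1A_2},\qquad t_{A_j},\ t_{A_1A_j},\ t_{A_2A_j}\quad(3\le j\le k)$$ are transcendental generators of $\mathcal{O}_{\mathfrak{X}_k}$.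
   Context: $F_k=\langle x_1,\ldots,x_k\rangle$ is the free group on $k$ generators. A representation $\rho:F_k\to\mathrm{SL}_2=\mathrm{SL}_2(\mathbf{k})$ is identified with the tuple $(A_1,\ldots,A_k)=(\rho(x_1),\ldots,\rho(x_k))\in(\mathrm{SL}_2)^k$, and its character is $\chi_\rho(g)=\operatorname{tr}\rho(g)$. The character variety $\mathfrak{X}(F_k,\mathrm{SL}_2)$ is the set of all characters $\chi_\rho$, with the structure of an affine variety whose coordinate ring $\mathcal{O}_{\mathfrak{X}_k}$ is the subalgebra of the ring of regular functions on $(\mathrm{SL}_2)^k$ generated by all trace functions $\rho\mapsto\operatorname{tr}\rho(g)$, $g\in F_k$. It is identified with the GIT quotient $(\mathrm{SL}_2)^k/\!/\mathrm{SL}_2$ by simultaneous conjugation. A set of elements of $\mathcal{O}_{\mathfrak{X}_k}$ is called a set of transcendental generators if it is a transcendence basis over $\mathbf{k}$: the elements are algebraically independent over $\mathbf{k}$ and every element of $\mathcal{O}_{\mathfrak{X}_k}$ is algebraic over the field they generate.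
   Formalization: The claim that the traces of length at most three generate the coordinate ring is asserted only when the characteristic is not 2 or k ≤ 3; in characteristic 2 with k ≥ 4 it is false, since the trace of A_1A_2A_3A_4 is not generated. The transcendence-basis claim is unrestricted. *)

theory Defs
  imports
    "HOL-Analysis.Determinants"
    "HOL-Computational_Algebra.Polynomial"
    "HOL-Algebra.Generated_Fields"
    "HOL-Algebra.Finite_Extensions"
    "HOL-Algebra.Indexed_Polynomials"
begin

section \<open>The group \<open>SL\<^sub>2\<close>\<close>

definition SL2 :: "('a::field ^ 2 ^ 2) monoid"
  where "SL2 = \<lparr>carrier = {A. det A = 1}, monoid.mult = (**), one = mat 1\<rparr>"

lemma group_SL2: "group (SL2 :: ('a::field ^ 2 ^ 2) monoid)"
proof (rule groupI)
  fix A :: "'a ^ 2 ^ 2"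
  assume A: "A \<in> carrier SL2"
  then have "invertible A"
    by (simp add: SL2_def invertible_det_nz)
  then obtain B where B: "A ** B = mat 1" "B ** A = mat 1"
    by (auto simp: invertible_def)
  from B(2) have "det B * det A = 1"
    by (metis det_mul det_I)
  with A B show "\<exists>B\<in>carrier SL2. B \<otimes>\<^bsub>SL2\<^esub> A = \<one>\<^bsub>SL2\<^esub>"
    by (auto simp: SL2_def)
qed (auto simp: SL2_def det_mul matrix_mul_assoc)


section \<open>The free group \<open>F\<^sub>k\<close>\<close>

text \<open>
  The letter \<open>(i, True)\<close> stands for the generator \<open>x\<^sub>i\<close> and \<open>(i, False)\<close> for its inverse.
  Elements of \<open>F\<^sub>k\<close> are the reduced words.
\<close>

type_synonym letter = "nat \<times> bool"

definition inv_letter :: "letter \<Rightarrow> letter"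
  where "inv_letter a = (fst a, \<not> snd a)"

definition reduced :: "letter list \<Rightarrow> bool"
  where "reduced w \<longleftrightarrow> successively (\<lambda>a b. b \<noteq> inv_letter a) w"

definition red_cons :: "letter \<Rightarrow> letter list \<Rightarrow> letter list"
  where "red_cons a w = (if w \<noteq> [] \<and> hd w = inv_letter a then tl w else a # w)"

definition free_group :: "nat \<Rightarrow> letter list monoid"
  where "free_group k =
    \<lparr>carrier = {w \<in> lists ({1..k} \<times> UNIV). reduced w},
     monoid.mult = (\<lambda>u v. foldr red_cons u v), one = []\<rparr>"

definition free_gen :: "nat \<Rightarrow> letter list"
  where "free_gen i = [(i, True)]"

lemma inv_letter_simps [simp]:
  "inv_letter (inv_letter a) = a" "inv_letter a \<noteq> a" "a \<noteq> inv_letter a"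
  "fst (inv_letter a) = fst a" "inv_letter (i, b) = (i, \<not> b)"
  by (cases a; simp add: inv_letter_def)+

lemma reduced_Nil [simp]: "reduced []"
  by (simp add: reduced_def)

lemma reduced_Cons:
  "reduced (a # w) \<longleftrightarrow> reduced w \<and> (w = [] \<or> hd w \<noteq> inv_letter a)"
  by (cases w) (auto simp: reduced_def)

lemma reduced_red_cons: "reduced w \<Longrightarrow> reduced (red_cons a w)"
  by (cases w) (auto simp: red_cons_def reduced_Cons)

lemma reduced_foldr: "reduced v \<Longrightarrow> reduced (foldr red_cons u v)"
  by (induction u) (auto intro: reduced_red_cons)

lemma red_cons_inv: "reduced w \<Longrightarrow> red_cons (inv_letter a) (red_cons a w) = w"
  by (cases w; cases "tl w") (auto simp: red_cons_def reduced_Cons)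

lemma foldr_red_cons_assoc:
  assumes "reduced v" "reduced w"
  shows "foldr red_cons (foldr red_cons u v) w = foldr red_cons u (foldr red_cons v w)"
proof (induction u)
  case Nil
  show ?case by simp
next
  case (Cons a u)
  let ?x = "foldr red_cons u v"
  have *: "foldr red_cons (red_cons a x) w = red_cons a (foldr red_cons x w)"
    if "reduced x" for x
  proof (cases "x \<noteq> [] \<and> hd x = inv_letter a")
    case True
    then obtain y where x: "x = inv_letter a # y" by (cases x) auto
    have "red_cons a (red_cons (inv_letter a) (foldr red_cons y w)) = foldr red_cons y w"
      using red_cons_inv[of "foldr red_cons y w" "inv_letter a"] reduced_foldr[OF assms(2)] by simp
    then show ?thesis by (simp add: x red_cons_def)
  next
    case False
    then show ?thesis by (auto simp: red_cons_def)
  qed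
  show ?case using *[OF reduced_foldr[OF assms(1)]] Cons by simp
qed

lemma set_red_cons: "set (red_cons a w) \<subseteq> insert a (set w)"
  by (cases w) (auto simp: red_cons_def)

lemma set_foldr_red_cons: "set (foldr red_cons u v) \<subseteq> set u \<union> set v"
proof (induction u)
  case (Cons a u)
  then show ?case using set_red_cons[of a "foldr red_cons u v"] by auto
qed simp

lemma foldr_red_cons_Nil: "reduced u \<Longrightarrow> foldr red_cons u [] = u"
  by (induction u) (auto simp: reduced_Cons red_cons_def)

lemma foldr_red_cons_inverse:
  "reduced v \<Longrightarrow> foldr red_cons (rev (map inv_letter u)) (foldr red_cons u v) = v"
  by (induction u arbitrary: v) (simp_all add: red_cons_inv reduced_foldr)

lemma group_free_group: "group (free_group k)"
proof (rule groupI)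
  fix u v assume u: "u \<in> carrier (free_group k)" and v: "v \<in> carrier (free_group k)"
  then have "set (foldr red_cons u v) \<subseteq> {1..k} \<times> UNIV"
    using set_foldr_red_cons[of u v] by (auto simp: free_group_def)
  with v show "u \<otimes>\<^bsub>free_group k\<^esub> v \<in> carrier (free_group k)"
    by (auto simp: free_group_def reduced_foldr)
next
  fix u assume u: "u \<in> carrier (free_group k)"
  define v where "v = foldr red_cons (rev (map inv_letter u)) []"
  have "set v \<subseteq> inv_letter ` set u"
    using set_foldr_red_cons[of "rev (map inv_letter u)" "[]"] by (simp add: v_def)
  also have "\<dots> \<subseteq> {1..k} \<times> UNIV"
    using u by (auto simp: free_group_def inv_letter_def)
  finally have "v \<in> carrier (free_group k)"
    by (auto simp: free_group_def v_def reduced_foldr)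
  moreover have "foldr red_cons v u = []"
  proof -
    have r: "reduced u" "reduced []" using u by (simp_all add: free_group_def)
    have "foldr red_cons v u = foldr red_cons (rev (map inv_letter u)) u"
      unfolding v_def by (subst foldr_red_cons_assoc) (simp_all add: r)
    also have "\<dots> = []"
      using foldr_red_cons_inverse[OF r(2), of u] by (simp add: foldr_red_cons_Nil r(1))
    finally show ?thesis .
  qed
  ultimately show "\<exists>v\<in>carrier (free_group k). v \<otimes>\<^bsub>free_group k\<^esub> u = \<one>\<^bsub>free_group k\<^esub>"
    by (auto simp: free_group_def)
qed (auto simp: free_group_def foldr_red_cons_assoc)


section \<open>Representations of \<open>F\<^sub>k\<close> and trace functions\<close>

definition SL2_tuples :: "nat \<Rightarrow> (nat \<Rightarrow> 'a::field ^ 2 ^ 2) set"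
  where "SL2_tuples k = {1..k} \<rightarrow>\<^sub>E carrier SL2"

definition letter_value :: "(nat \<Rightarrow> 'a::field ^ 2 ^ 2) \<Rightarrow> letter \<Rightarrow> 'a ^ 2 ^ 2"
  where "letter_value A a = (if snd a then A (fst a) else inv\<^bsub>SL2\<^esub> (A (fst a)))"

text \<open>
  The representation \<open>\<rho>\<close> of \<open>F\<^sub>k\<close> identified with the tuple \<open>A\<close>: by the two lemmas below it is
  the only homomorphism with \<open>\<rho>(x\<^sub>i) = A\<^sub>i\<close>.
\<close>

definition rep :: "(nat \<Rightarrow> 'a::field ^ 2 ^ 2) \<Rightarrow> letter list \<Rightarrow> 'a ^ 2 ^ 2"
  where "rep A w = foldr (\<lambda>a M. letter_value A a \<otimes>\<^bsub>SL2\<^esub> M) w \<one>\<^bsub>SL2\<^esub>"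

lemma rep_hom:
  assumes "A \<in> SL2_tuples k"
  shows "rep A \<in> hom (free_group k) SL2" and "i \<in> {1..k} \<Longrightarrow> rep A (free_gen i) = A i"
proof -
  interpret S: group "SL2 :: ('a ^ 2 ^ 2) monoid" by (rule group_SL2)
  have AC: "A i \<in> carrier SL2" if "i \<in> {1..k}" for i
    using assms that by (auto simp: SL2_tuples_def)
  show "rep A (free_gen i) = A i" if "i \<in> {1..k}"
    using AC[OF that] by (simp add: rep_def free_gen_def letter_value_def)
  have lv: "letter_value A a \<in> carrier SL2" if "fst a \<in> {1..k}" for a
    using AC[OF that] by (simp add: letter_value_def)
  have lvi: "letter_value A (inv_letter a) = inv\<^bsub>SL2\<^esub> (letter_value A a)" if "fst a \<in> {1..k}" for a
    using AC[OF that] by (cases a) (auto simp: letter_value_def)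
  have rc: "rep A w \<in> carrier SL2" if "set w \<subseteq> {1..k} \<times> UNIV" for w
    using that by (induction w) (auto simp: rep_def intro!: S.m_closed lv)
  have red: "rep A (red_cons a w) = letter_value A a \<otimes>\<^bsub>SL2\<^esub> rep A w"
    if "fst a \<in> {1..k}" "set w \<subseteq> {1..k} \<times> UNIV" for a w
  proof (cases "w \<noteq> [] \<and> hd w = inv_letter a")
    case True
    then obtain y where w: "w = inv_letter a # y" by (cases w) auto
    have "rep A w = inv\<^bsub>SL2\<^esub> (letter_value A a) \<otimes>\<^bsub>SL2\<^esub> rep A y"
      using that by (simp add: w rep_def lvi)
    moreover have "rep A y \<in> carrier SL2" using rc[of y] that(2) by (simp add: w)
    ultimately show ?thesis
      using lv[OF that(1)] by (simp add: w red_cons_def S.m_assoc[symmetric])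
  next
    case False
    then show ?thesis by (auto simp: red_cons_def rep_def)
  qed
  have "rep A (foldr red_cons u v) = rep A u \<otimes>\<^bsub>SL2\<^esub> rep A v"
    if "set u \<subseteq> {1..k} \<times> UNIV" "set v \<subseteq> {1..k} \<times> UNIV" for u v
    using that(1)
  proof (induction u)
    case Nil
    then show ?case using rc[OF that(2)] by (simp add: rep_def)
  next
    case (Cons a u)
    have "set (foldr red_cons u v) \<subseteq> {1..k} \<times> UNIV"
      using set_foldr_red_cons[of u v] Cons.prems that(2) by auto
    then have "rep A (foldr red_cons (a # u) v) = letter_value A a \<otimes>\<^bsub>SL2\<^esub> rep A (foldr red_cons u v)"
      using Cons.prems by (auto simp: red)
    also have "\<dots> = letter_value A a \<otimes>\<^bsub>SL2\<^esub> (rep A u \<otimes>\<^bsub>SL2\<^esub> rep A v)"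
      using Cons by simp
    also have "\<dots> = rep A (a # u) \<otimes>\<^bsub>SL2\<^esub> rep A v"
      using Cons.prems lv[of a] rc[of u] rc[OF that(2)] by (auto simp: rep_def S.m_assoc)
    finally show ?case .
  qed
  then show "rep A \<in> hom (free_group k) SL2"
    using rc by (intro homI) (simp_all add: free_group_def lists_eq_set)
qed

lemma rep_unique:
  assumes "A \<in> SL2_tuples k" "\<rho> \<in> hom (free_group k) SL2" "\<And>i. i \<in> {1..k} \<Longrightarrow> \<rho> (free_gen i) = A i"
    and "w \<in> carrier (free_group k)"
  shows "\<rho> w = rep A w"
proof -
  interpret S: group "SL2 :: ('a ^ 2 ^ 2) monoid" by (rule group_SL2)
  interpret F: group "free_group k" by (rule group_free_group)
  interpret H: group_hom "free_group k" SL2 \<rho>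
    by unfold_locales (rule assms(2))
  have letter: "\<rho> [a] = letter_value A a" if "fst a \<in> {1..k}" for a
  proof (cases "snd a")
    case True
    then have "[a] = free_gen (fst a)" by (cases a) (simp add: free_gen_def)
    then show ?thesis using assms(3)[OF that] True by (simp add: letter_value_def)
  next
    case False
    have "[a] = inv\<^bsub>free_group k\<^esub> (free_gen (fst a))"
      using that False
      by (intro F.inv_equality[symmetric])
        (cases a; auto simp: free_group_def free_gen_def red_cons_def reduced_Cons)+
    moreover have "free_gen (fst a) \<in> carrier (free_group k)"
      using that by (auto simp: free_group_def free_gen_def reduced_Cons)
    ultimately show ?thesis using assms(3)[OF that] False by (simp add: letter_value_def)
  qed
  show ?thesis using assms(4)
  proof (induction w)
    case Nil
    show ?case using H.hom_one by (simp add: rep_def free_group_def)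
  next
    case (Cons a w)
    then have w: "w \<in> carrier (free_group k)" and a: "[a] \<in> carrier (free_group k)" "fst a \<in> {1..k}"
      by (auto simp: free_group_def reduced_Cons)
    have "a # w = [a] \<otimes>\<^bsub>free_group k\<^esub> w"
      using Cons.prems by (auto simp: free_group_def reduced_Cons red_cons_def)
    then have "\<rho> (a # w) = \<rho> [a] \<otimes>\<^bsub>SL2\<^esub> \<rho> w"
      using H.hom_mult a w by simp
    then show ?case using Cons.IH[OF w] letter a by (simp add: rep_def)
  qed
qed

definition character :: "(letter list \<Rightarrow> 'a::field ^ 2 ^ 2) \<Rightarrow> letter list \<Rightarrow> 'a"
  where "character \<rho> g = trace (\<rho> g)"

definition tr_on_tuples ::
  "nat \<Rightarrow> ((nat \<Rightarrow> 'a::field ^ 2 ^ 2) \<Rightarrow> 'a ^ 2 ^ 2) \<Rightarrow> (nat \<Rightarrow> 'a ^ 2 ^ 2) \<Rightarrow> 'a"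
  where "tr_on_tuples k M = (\<lambda>A\<in>SL2_tuples k. trace (M A))"

definition trace_fun :: "nat \<Rightarrow> letter list \<Rightarrow> (nat \<Rightarrow> 'a::field ^ 2 ^ 2) \<Rightarrow> 'a"
  where "trace_fun k g = (\<lambda>A\<in>SL2_tuples k. character (rep A) g)"


section \<open>Rings of functions on \<open>(SL\<^sub>2)\<^sup>k\<close>\<close>

text \<open>
  Functions on \<open>(SL\<^sub>2)\<^sup>k\<close> are extensional, so that equality of functions is equality on
  \<open>(SL\<^sub>2)\<^sup>k\<close>. Over an infinite field, such functions represent the elements of the coordinate
  ring of the (reduced) variety \<open>(SL\<^sub>2)\<^sup>k\<close> faithfully.
\<close>

definition fun_ring :: "nat \<Rightarrow> ((nat \<Rightarrow> 'a::field ^ 2 ^ 2) \<Rightarrow> 'a) ring"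
  where "fun_ring k =
    \<lparr>carrier = SL2_tuples k \<rightarrow>\<^sub>E UNIV,
     monoid.mult = (\<lambda>f g. \<lambda>A\<in>SL2_tuples k. f A * g A), one = (\<lambda>A\<in>SL2_tuples k. 1),
     zero = (\<lambda>A\<in>SL2_tuples k. 0), add = (\<lambda>f g. \<lambda>A\<in>SL2_tuples k. f A + g A)\<rparr>"

definition constants :: "nat \<Rightarrow> ((nat \<Rightarrow> 'a::field ^ 2 ^ 2) \<Rightarrow> 'a) set"
  where "constants k = range (\<lambda>c. \<lambda>A\<in>SL2_tuples k. c)"

definition entries :: "nat \<Rightarrow> ((nat \<Rightarrow> 'a::field ^ 2 ^ 2) \<Rightarrow> 'a) set"
  where "entries k = {\<lambda>A\<in>SL2_tuples k. A i $ r $ s | i r s. i \<in> {1..k}}"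

definition generated_algebra :: "('b, 'c) ring_scheme \<Rightarrow> 'b set \<Rightarrow> 'b set \<Rightarrow> 'b set"
  where "generated_algebra R K S = generate_ring R (K \<union> S)"

definition regular_ring :: "nat \<Rightarrow> ((nat \<Rightarrow> 'a::field ^ 2 ^ 2) \<Rightarrow> 'a) ring"
  where "regular_ring k =
    fun_ring k \<lparr>carrier := generated_algebra (fun_ring k) (constants k) (entries k)\<rparr>"

text \<open>The coordinate ring of the character variety \<open>\<XX>(F\<^sub>k, SL\<^sub>2)\<close>.\<close>

definition coord_ring :: "nat \<Rightarrow> ((nat \<Rightarrow> 'a::field ^ 2 ^ 2) \<Rightarrow> 'a) ring"
  where "coord_ring k = regular_ring k
    \<lparr>carrier := generated_algebra (regular_ring k) (constants k)
       (trace_fun k ` carrier (free_group k))\<rparr>"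


section \<open>Transcendence bases\<close>

definition frac_rel :: "('b, 'c) ring_scheme \<Rightarrow> (('b \<times> 'b) \<times> ('b \<times> 'b)) set"
  where "frac_rel R = {((a, b), (c, d)). a \<in> carrier R \<and> b \<in> carrier R - {\<zero>\<^bsub>R\<^esub>} \<and>
    c \<in> carrier R \<and> d \<in> carrier R - {\<zero>\<^bsub>R\<^esub>} \<and> a \<otimes>\<^bsub>R\<^esub> d = c \<otimes>\<^bsub>R\<^esub> b}"

definition frac_class :: "('b, 'c) ring_scheme \<Rightarrow> 'b \<Rightarrow> 'b \<Rightarrow> ('b \<times> 'b) set"
  where "frac_class R a b = frac_rel R `` {(a, b)}"

text \<open>The field of fractions of a domain \<open>R\<close>.\<close>

definition fraction_field :: "('b, 'c) ring_scheme \<Rightarrow> ('b \<times> 'b) set ring"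
  where "fraction_field R =
    \<lparr>carrier = (carrier R \<times> (carrier R - {\<zero>\<^bsub>R\<^esub>})) // frac_rel R,
     monoid.mult = (\<lambda>P Q. \<Union>x\<in>P. \<Union>y\<in>Q.
       frac_class R (fst x \<otimes>\<^bsub>R\<^esub> fst y) (snd x \<otimes>\<^bsub>R\<^esub> snd y)),
     one = frac_class R \<one>\<^bsub>R\<^esub> \<one>\<^bsub>R\<^esub>,
     zero = frac_class R \<zero>\<^bsub>R\<^esub> \<one>\<^bsub>R\<^esub>,
     add = (\<lambda>P Q. \<Union>x\<in>P. \<Union>y\<in>Q.
       frac_class R (fst x \<otimes>\<^bsub>R\<^esub> snd y \<oplus>\<^bsub>R\<^esub> fst y \<otimes>\<^bsub>R\<^esub> snd x) (snd x \<otimes>\<^bsub>R\<^esub> snd y))\<rparr>"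

lemma UN_UN_const:
  assumes "p \<in> P" "q \<in> Q" "\<And>x y. x \<in> P \<Longrightarrow> y \<in> Q \<Longrightarrow> h x y = c"
  shows "(\<Union>x\<in>P. \<Union>y\<in>Q. h x y) = c"
proof -
  have "(\<Union>x\<in>P. \<Union>y\<in>Q. h x y) = (\<Union>x\<in>P. \<Union>y\<in>Q. c)" using assms(3) by simp
  also have "\<dots> = c" using assms(1,2) by blast
  finally show ?thesis .
qed

lemma equiv_frac_rel: assumes "domain R"
  shows "equiv (carrier R \<times> (carrier R - {\<zero>\<^bsub>R\<^esub>})) (frac_rel R)"
proof -
  interpret domain R by fact
  have tr: "trans (frac_rel R)"
  proof (rule transI)
    fix x y z assume "(x,y) \<in> frac_rel R" "(y,z) \<in> frac_rel R"
    then obtain a b c d e f where x: "x=(a,b)" "y=(c,d)" "z=(e,f)"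
      and C: "a\<in>carrier R" "b\<in>carrier R" "c\<in>carrier R" "d\<in>carrier R" "e\<in>carrier R" "f\<in>carrier R"
      and nz: "b\<noteq>\<zero>\<^bsub>R\<^esub>" "d\<noteq>\<zero>\<^bsub>R\<^esub>" "f\<noteq>\<zero>\<^bsub>R\<^esub>" and E: "a \<otimes>\<^bsub>R\<^esub> d = c \<otimes>\<^bsub>R\<^esub> b" "c \<otimes>\<^bsub>R\<^esub> f = e \<otimes>\<^bsub>R\<^esub> d"
      by (auto simp: frac_rel_def)
    have "d \<otimes>\<^bsub>R\<^esub> (a \<otimes>\<^bsub>R\<^esub> f) = (a \<otimes>\<^bsub>R\<^esub> d) \<otimes>\<^bsub>R\<^esub> f" using C by (simp add: m_ac)
    also have "\<dots> = (c \<otimes>\<^bsub>R\<^esub> f) \<otimes>\<^bsub>R\<^esub> b" using C by (simp add: E m_ac)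
    also have "\<dots> = d \<otimes>\<^bsub>R\<^esub> (e \<otimes>\<^bsub>R\<^esub> b)" unfolding E using C by (simp add: m_ac)
    finally have "a \<otimes>\<^bsub>R\<^esub> f = e \<otimes>\<^bsub>R\<^esub> b" using C nz by (meson m_closed m_lcancel)
    then show "(x,z) \<in> frac_rel R" using C nz x by (auto simp: frac_rel_def)
  qed
  show ?thesis using tr by (auto simp: equiv_def refl_on_def sym_def frac_rel_def)
qed

lemma field_fraction_field: assumes "domain R" shows "field (fraction_field R)"
proof -
  interpret domain R by fact
  note eqv = equiv_frac_rel[OF assms]
  let ?B = "carrier R \<times> (carrier R - {\<zero>\<^bsub>R\<^esub>})"
  let ?F = "fraction_field R"
  have ceq: "frac_class R a b = frac_class R c d \<longleftrightarrow> a \<otimes>\<^bsub>R\<^esub> d = c \<otimes>\<^bsub>R\<^esub> b"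
    if "(a,b)\<in>?B" "(c,d)\<in>?B" for a b c d
    using eq_equiv_class_iff[OF eqv that] that by (auto simp: frac_class_def frac_rel_def)
  have carr: "carrier ?F = {frac_class R a b | a b. (a,b)\<in>?B}"
    by (auto simp: fraction_field_def quotient_def frac_class_def)
  have nz: "x \<otimes>\<^bsub>R\<^esub> y \<noteq> \<zero>\<^bsub>R\<^esub>" if "x \<in> carrier R" "y\<in>carrier R" "x\<noteq>\<zero>\<^bsub>R\<^esub>" "y\<noteq>\<zero>\<^bsub>R\<^esub>" for x y
    using that integral by blast
  have mult: "frac_class R a b \<otimes>\<^bsub>?F\<^esub> frac_class R c d = frac_class R (a \<otimes>\<^bsub>R\<^esub> c) (b \<otimes>\<^bsub>R\<^esub> d)"
    if "(a,b)\<in>?B" "(c,d)\<in>?B" for a b c d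
  proof -
    have "frac_class R (fst x \<otimes>\<^bsub>R\<^esub> fst y) (snd x \<otimes>\<^bsub>R\<^esub> snd y) = frac_class R (a \<otimes>\<^bsub>R\<^esub> c) (b \<otimes>\<^bsub>R\<^esub> d)"
      if "x \<in> frac_class R a b" "y \<in> frac_class R c d" for x y
    proof -
      obtain a' b' c' d' where x: "x=(a',b')" "y=(c',d')" by (cases x, cases y)
      have C: "(a',b')\<in>?B" "(c',d')\<in>?B" and e: "a \<otimes>\<^bsub>R\<^esub> b' = a' \<otimes>\<^bsub>R\<^esub> b" "c \<otimes>\<^bsub>R\<^esub> d' = c' \<otimes>\<^bsub>R\<^esub> d"
        using that by (auto simp: x frac_class_def frac_rel_def)
      have "a' \<otimes>\<^bsub>R\<^esub> c' \<otimes>\<^bsub>R\<^esub> (b \<otimes>\<^bsub>R\<^esub> d) = (a' \<otimes>\<^bsub>R\<^esub> b) \<otimes>\<^bsub>R\<^esub> (c' \<otimes>\<^bsub>R\<^esub> d)" using C \<open>(a,b)\<in>?B\<close> \<open>(c,d)\<in>?B\<close>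
        by (auto simp: m_ac)
      also have "\<dots> = a \<otimes>\<^bsub>R\<^esub> c \<otimes>\<^bsub>R\<^esub> (b' \<otimes>\<^bsub>R\<^esub> d')" unfolding e[symmetric]
        using C \<open>(a,b)\<in>?B\<close> \<open>(c,d)\<in>?B\<close> by (auto simp: m_ac)
      finally show ?thesis unfolding x fst_conv snd_conv using C \<open>(a,b)\<in>?B\<close> \<open>(c,d)\<in>?B\<close>
        by (subst ceq) (auto intro: nz dest: integral)
    qed
    moreover have "(a,b) \<in> frac_class R a b" "(c,d)\<in>frac_class R c d" using that
      by (auto simp: frac_class_def frac_rel_def)
    ultimately show ?thesis unfolding fraction_field_def monoid.simps ring.simps
      by (intro UN_UN_const)
  qed
  have add: "frac_class R a b \<oplus>\<^bsub>?F\<^esub> frac_class R c d = frac_class R (a \<otimes>\<^bsub>R\<^esub> d \<oplus>\<^bsub>R\<^esub> c \<otimes>\<^bsub>R\<^esub> b) (b \<otimes>\<^bsub>R\<^esub> d)"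
    if "(a,b)\<in>?B" "(c,d)\<in>?B" for a b c d
  proof -
    have "frac_class R (fst x \<otimes>\<^bsub>R\<^esub> snd y \<oplus>\<^bsub>R\<^esub> fst y \<otimes>\<^bsub>R\<^esub> snd x) (snd x \<otimes>\<^bsub>R\<^esub> snd y) = frac_class R (a \<otimes>\<^bsub>R\<^esub> d \<oplus>\<^bsub>R\<^esub> c \<otimes>\<^bsub>R\<^esub> b) (b \<otimes>\<^bsub>R\<^esub> d)"
      if "x \<in> frac_class R a b" "y \<in> frac_class R c d" for x y
    proof -
      obtain a' b' c' d' where x: "x=(a',b')" "y=(c',d')" by (cases x, cases y)
      have C: "(a',b')\<in>?B" "(c',d')\<in>?B" and e: "a \<otimes>\<^bsub>R\<^esub> b' = a' \<otimes>\<^bsub>R\<^esub> b" "c \<otimes>\<^bsub>R\<^esub> d' = c' \<otimes>\<^bsub>R\<^esub> d"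
        using that by (auto simp: x frac_class_def frac_rel_def)
      have "(a' \<otimes>\<^bsub>R\<^esub> d' \<oplus>\<^bsub>R\<^esub> c' \<otimes>\<^bsub>R\<^esub> b') \<otimes>\<^bsub>R\<^esub> (b \<otimes>\<^bsub>R\<^esub> d) = (a' \<otimes>\<^bsub>R\<^esub> b) \<otimes>\<^bsub>R\<^esub> (d' \<otimes>\<^bsub>R\<^esub> d) \<oplus>\<^bsub>R\<^esub> (c' \<otimes>\<^bsub>R\<^esub> d) \<otimes>\<^bsub>R\<^esub> (b' \<otimes>\<^bsub>R\<^esub> b)"
        using C \<open>(a,b)\<in>?B\<close> \<open>(c,d)\<in>?B\<close> by (auto simp: m_ac l_distr r_distr)
      also have "\<dots> = (a \<otimes>\<^bsub>R\<^esub> d \<oplus>\<^bsub>R\<^esub> c \<otimes>\<^bsub>R\<^esub> b) \<otimes>\<^bsub>R\<^esub> (b' \<otimes>\<^bsub>R\<^esub> d')" unfolding e[symmetric]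
        using C \<open>(a,b)\<in>?B\<close> \<open>(c,d)\<in>?B\<close> by (auto simp: m_ac l_distr r_distr)
      finally show ?thesis unfolding x fst_conv snd_conv using C \<open>(a,b)\<in>?B\<close> \<open>(c,d)\<in>?B\<close>
        by (subst ceq) (auto intro: nz dest: integral)
    qed
    moreover have "(a,b) \<in> frac_class R a b" "(c,d)\<in>frac_class R c d" using that
      by (auto simp: frac_class_def frac_rel_def)
    ultimately show ?thesis unfolding fraction_field_def monoid.simps ring.simps
      by (intro UN_UN_const)
  qed
  have one: "\<one>\<^bsub>?F\<^esub> = frac_class R \<one>\<^bsub>R\<^esub> \<one>\<^bsub>R\<^esub>" and zero: "\<zero>\<^bsub>?F\<^esub> = frac_class R \<zero>\<^bsub>R\<^esub> \<one>\<^bsub>R\<^esub>"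
    by (simp_all add: fraction_field_def)
  have mc: "(a \<otimes>\<^bsub>R\<^esub> c, b \<otimes>\<^bsub>R\<^esub> d) \<in> ?B" "(a \<otimes>\<^bsub>R\<^esub> d \<oplus>\<^bsub>R\<^esub> c \<otimes>\<^bsub>R\<^esub> b, b \<otimes>\<^bsub>R\<^esub> d) \<in> ?B" if "(a,b)\<in>?B" "(c,d)\<in>?B" for a b c d
    using that nz by auto
  have o: "(\<one>\<^bsub>R\<^esub>,\<one>\<^bsub>R\<^esub>) \<in> ?B" "(\<zero>\<^bsub>R\<^esub>,\<one>\<^bsub>R\<^esub>) \<in> ?B" by auto
  have "cring ?F"
  proof (rule cringI)
    show "abelian_group ?F"
    proof (rule abelian_groupI)
      fix x y assume "x \<in> carrier ?F" "y \<in> carrier ?F"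
      then obtain a b c d where x: "x = frac_class R a b" "y = frac_class R c d"
        and C: "(a,b)\<in>?B" "(c,d)\<in>?B" by (auto simp: carr)
      show "x \<oplus>\<^bsub>?F\<^esub> y \<in> carrier ?F" using mc(2)[OF C] add[OF C] x carr by blast
      show "x \<oplus>\<^bsub>?F\<^esub> y = y \<oplus>\<^bsub>?F\<^esub> x" using C by (auto simp: x add a_comm m_comm)
      show "\<zero>\<^bsub>?F\<^esub> \<oplus>\<^bsub>?F\<^esub> x = x" using C by (auto simp: x add zero)
      have "frac_class R (\<ominus>\<^bsub>R\<^esub> a) b \<oplus>\<^bsub>?F\<^esub> x = \<zero>\<^bsub>?F\<^esub>" unfolding x zero
        using C by (subst add) (auto simp: ceq nz l_minus l_neg)
      moreover have "frac_class R (\<ominus>\<^bsub>R\<^esub> a) b \<in> carrier ?F" using C by (auto simp: carr)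
      ultimately show "\<exists>y\<in>carrier ?F. y \<oplus>\<^bsub>?F\<^esub> x = \<zero>\<^bsub>?F\<^esub>" by blast
      fix z assume "z \<in> carrier ?F"
      then obtain e f where z: "z = frac_class R e f" "(e,f)\<in>?B" by (auto simp: carr)
      show "x \<oplus>\<^bsub>?F\<^esub> y \<oplus>\<^bsub>?F\<^esub> z = x \<oplus>\<^bsub>?F\<^esub> (y \<oplus>\<^bsub>?F\<^esub> z)"
        unfolding x z add[OF C] add[OF C(2) z(2)] add[OF mc(2)[OF C] z(2)] add[OF C(1) mc(2)[OF C(2) z(2)]]
        using C z by (auto simp: l_distr r_distr m_ac a_ac)
    qed (use o carr zero in blast)
    show "comm_monoid ?F"
    proof (rule comm_monoidI)
      fix x y assume "x \<in> carrier ?F" "y \<in> carrier ?F"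
      then obtain a b c d where x: "x = frac_class R a b" "y = frac_class R c d"
        and C: "(a,b)\<in>?B" "(c,d)\<in>?B" by (auto simp: carr)
      show "x \<otimes>\<^bsub>?F\<^esub> y \<in> carrier ?F" using mc(1)[OF C] mult[OF C] x carr by blast
      show "x \<otimes>\<^bsub>?F\<^esub> y = y \<otimes>\<^bsub>?F\<^esub> x" using C by (auto simp: x mult m_comm)
      show "\<one>\<^bsub>?F\<^esub> \<otimes>\<^bsub>?F\<^esub> x = x" using C by (auto simp: x mult one)
      fix z assume "z \<in> carrier ?F"
      then obtain e f where z: "z = frac_class R e f" "(e,f)\<in>?B" by (auto simp: carr)
      show "x \<otimes>\<^bsub>?F\<^esub> y \<otimes>\<^bsub>?F\<^esub> z = x \<otimes>\<^bsub>?F\<^esub> (y \<otimes>\<^bsub>?F\<^esub> z)"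
        unfolding x z mult[OF C] mult[OF C(2) z(2)] mult[OF mc(1)[OF C] z(2)] mult[OF C(1) mc(1)[OF C(2) z(2)]]
        using C z by (auto simp: m_ac)
    qed (use o carr one in blast)
    fix x y z assume "x \<in> carrier ?F" "y \<in> carrier ?F" "z \<in> carrier ?F"
    then obtain a b c d e f where x: "x = frac_class R a b" "y = frac_class R c d" "z = frac_class R e f"
      and C: "(a,b)\<in>?B" "(c,d)\<in>?B" "(e,f)\<in>?B" by (auto simp: carr)
    show "(x \<oplus>\<^bsub>?F\<^esub> y) \<otimes>\<^bsub>?F\<^esub> z = x \<otimes>\<^bsub>?F\<^esub> z \<oplus>\<^bsub>?F\<^esub> y \<otimes>\<^bsub>?F\<^esub> z"
      unfolding x add[OF C(1,2)] mult[OF C(1,3)] mult[OF C(2,3)] mult[OF mc(2)[OF C(1,2)] C(3)] add[OF mc(1)[OF C(1,3)] mc(1)[OF C(2,3)]]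
      using C by (subst ceq) (auto simp: nz l_distr r_distr m_ac)
  qed
  then interpret F: cring ?F .
  show ?thesis
  proof (rule F.cring_fieldI2)
    show "\<zero>\<^bsub>?F\<^esub> \<noteq> \<one>\<^bsub>?F\<^esub>" unfolding zero one using o ceq by auto
    fix x assume "x \<in> carrier ?F" "x \<noteq> \<zero>\<^bsub>?F\<^esub>"
    then obtain a b where x: "x = frac_class R a b" "(a,b)\<in>?B" by (auto simp: carr)
    with \<open>x \<noteq> \<zero>\<^bsub>?F\<^esub>\<close> have a: "(b,a) \<in> ?B" using ceq[OF x(2) o(2)] by (auto simp: zero)
    have "x \<otimes>\<^bsub>?F\<^esub> frac_class R b a = \<one>\<^bsub>?F\<^esub>" unfolding x one mult[OF x(2) a] using x a
      by (subst ceq) (auto simp: nz m_comm)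
    moreover have "frac_class R b a \<in> carrier ?F" using a carr by blast
    ultimately show "\<exists>y\<in>carrier ?F. x \<otimes>\<^bsub>?F\<^esub> y = \<one>\<^bsub>?F\<^esub>" by blast
  qed
qed

text \<open>
  The value of the indexed polynomial \<open>p\<close>, whose variables are themselves elements of \<open>R\<close>, when
  every variable is replaced by the element it is.
\<close>

definition poly_value :: "('b, 'c) ring_scheme \<Rightarrow> ('b multiset \<Rightarrow> 'b) \<Rightarrow> 'b"
  where "poly_value R p = (\<Oplus>\<^bsub>R\<^esub>m\<in>{m. p m \<noteq> \<zero>\<^bsub>R\<^esub>}.
    p m \<otimes>\<^bsub>R\<^esub> (\<Otimes>\<^bsub>R\<^esub>s\<in>set_mset m. s [^]\<^bsub>R\<^esub> count m s))"

definition algebraically_independent :: "('b, 'c) ring_scheme \<Rightarrow> 'b set \<Rightarrow> 'b set \<Rightarrow> bool"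
  where "algebraically_independent R K S \<longleftrightarrow>
    (\<forall>p \<in> ring.indexed_pset R S K. poly_value R p = \<zero>\<^bsub>R\<^esub> \<longrightarrow> (\<forall>m. p m = \<zero>\<^bsub>R\<^esub>))"

text \<open>
  Meant for a domain \<open>R\<close> containing the field \<open>K\<close>. The field generated by \<open>S\<close> over \<open>K\<close> is taken
  inside the field of fractions of \<open>R\<close>, into which \<open>R\<close> embeds by \<open>a \<mapsto> a/1\<close>.
\<close>

definition transcendental_generators :: "('b, 'c) ring_scheme \<Rightarrow> 'b set \<Rightarrow> 'b set \<Rightarrow> bool"
  where "transcendental_generators R K S \<longleftrightarrow>
    S \<subseteq> carrier R \<and> algebraically_independent R K S \<and>
    (\<forall>f \<in> carrier R. (ring.algebraic (fraction_field R) over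
       generate_field (fraction_field R) ((\<lambda>a. frac_class R a \<one>\<^bsub>R\<^esub>) ` (K \<union> S))) (frac_class R f \<one>\<^bsub>R\<^esub>))"

end

theory Submission
  imports Defs
begin

text \<open>
  The Cayley--Hamilton identity lets one permute the letters of a word inside a trace and delete
  repeated letters, at the cost of traces of shorter words; a trace of four or more distinct letters
  reduces by a multilinear identity for \<open>2 tr(MNPQ)\<close>. This gives generation.

  For generic \<open>A\<^sub>1, A\<^sub>2\<close> the matrices \<open>1, A\<^sub>1, A\<^sub>2, A\<^sub>1A\<^sub>2\<close> form a basis, so
  \<open>tr(XY)\<close> is a rational function of the traces of \<open>X\<close> and \<open>Y\<close> against this basis. As
  \<open>tr(A\<^sub>1A\<^sub>2A\<^sub>j)\<close> is quadratic over the proposed basis, all traces are algebraic over it.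
  Independence holds because the proposed functions take arbitrary values once
  \<open>tr(A\<^sub>1A\<^sub>2)\<close> avoids finitely many values depending on \<open>tr(A\<^sub>1)\<close> and \<open>tr(A\<^sub>2)\<close>.
\<close>

text \<open>The factor 2 in the four-letter identity is the only place where the characteristic
  matters, and words of at most three distinct letters never reach it; hence the condition
  \<open>CHAR('a) \<noteq> 2 \<or> k \<le> 3\<close> on generation alone. The transcendence
  statement has to hold in every characteristic, so algebraicity cannot start from the generators.
  It runs over all words of the free group instead: the traces of a word against the four basis
  matrices are carried along, and concatenation is controlled after multiplication by a
  discriminant, which is then cancelled among algebraic elements. Cancelling takes place in a
  fraction field, so the coordinate ring must be a domain; this is seen by restricting functions to
  polynomial curves. For independence, the exceptional values constrain one variable only: with all
  other values fixed arbitrarily, a relation already vanishes identically in that variable.\<close>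

section \<open>Trace identities for two-by-two matrices\<close>

lemma trace_2: "trace (M :: 'a::comm_semiring_1 ^ 2 ^ 2) = M $ 1 $ 1 + M $ 2 $ 2"
  by (simp add: trace_def sum_2)

lemma matrix_mult_2:
  "((M :: 'a::comm_semiring_1 ^ 2 ^ 2) ** N) $ i $ j = M $ i $ 1 * N $ 1 $ j + M $ i $ 2 * N $ 2 $ j"
  by (simp add: matrix_matrix_mult_def sum_2)

lemma trace_mult_commute: "trace (M ** N) = trace (N ** (M :: 'a::comm_semiring_1 ^ 2 ^ 2))"
  by (simp add: trace_2 matrix_mult_2 algebra_simps)

text \<open>The polarised Cayley--Hamilton identity \<open>MN + NM = tr(M) N + tr(N) M + (tr(MN) - tr(M) tr(N))\<close>,
  multiplied by \<open>Z\<close>.\<close>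

lemma trace_swap:
  fixes M N Z :: "'a::comm_ring_1 ^ 2 ^ 2"
  shows "trace (M ** N ** Z) = trace M * trace (N ** Z) + trace N * trace (M ** Z)
    + (trace (M ** N) - trace M * trace N) * trace Z - trace (N ** M ** Z)"
  by (simp add: trace_2 matrix_mult_2 algebra_simps)

lemma trace_square:
  fixes M Z :: "'a::field ^ 2 ^ 2"
  assumes "det M = 1"
  shows "trace (M ** M ** Z) = trace M * trace (M ** Z) - trace Z"
proof -
  have "trace (M ** M ** Z) = trace M * trace (M ** Z) - det M * trace Z"
    by (simp add: trace_2 matrix_mult_2 det_2 algebra_simps)
  with assms show ?thesis by simp
qed

lemma trace_square_SL2:
  fixes M :: "'a::field ^ 2 ^ 2"
  shows "det M = 1 \<Longrightarrow> trace (M ** M) = trace M * trace M - 2"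
  using trace_square[of M "mat 1"] by (simp add: trace_I)

text \<open>On SL_2 the inverse of \<open>M\<close> is its adjugate
  \<open>mat (trace M) - M\<close>; by linearity an inverse letter inside a trace is traded for the
  letter itself and its deletion.\<close>

lemma trace_adjugate:
  fixes M N P :: "'a::comm_ring_1 ^ 2 ^ 2"
  shows "trace (N ** (mat (trace M) - M) ** P) = trace M * trace (N ** P) - trace (N ** M ** P)"
  by (simp add: trace_2 matrix_mult_2 mat_def algebra_simps)

text \<open>Modulo products of traces of shorter words, \<open>trace_swap\<close> makes the trace
  antisymmetric under adjacent transpositions. Rotating four factors is an odd permutation that
  leaves the trace unchanged, so twice the trace reduces to shorter ones.\<close>

lemma trace_four:
  fixes M N P Q :: "'a::comm_ring_1 ^ 2 ^ 2"
  shows "2 * trace (M ** N ** P ** Q) =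
    trace M * trace (N ** P ** Q) + trace N * trace (M ** P ** Q)
    + trace P * trace (M ** N ** Q) + trace Q * trace (M ** N ** P)
    + trace (M ** N) * trace (P ** Q) - trace (M ** P) * trace (N ** Q)
    + trace (M ** Q) * trace (N ** P)
    - trace M * trace N * trace (P ** Q) - trace M * trace Q * trace (N ** P)
    - trace N * trace P * trace (M ** Q) - trace P * trace Q * trace (M ** N)
    + trace M * trace N * trace P * trace Q"
  by (simp add: trace_2 matrix_mult_2 algebra_simps)

lemma SL2_simps [simp]:
  "M \<in> carrier SL2 \<longleftrightarrow> det M = 1" "M \<otimes>\<^bsub>SL2\<^esub> N = M ** N" "\<one>\<^bsub>SL2\<^esub> = mat 1"
  by (simp_all add: SL2_def)

lemma inv_SL2:
  fixes M :: "'a::field ^ 2 ^ 2"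
  assumes "det M = 1"
  shows "inv\<^bsub>SL2\<^esub> M = mat (trace M) - M"
proof (rule group.inv_equality[OF group_SL2])
  show "(mat (trace M) - M) \<otimes>\<^bsub>SL2\<^esub> M = \<one>\<^bsub>SL2\<^esub>"
    using assms by (simp add: vec_eq_iff forall_2 matrix_mult_2 mat_def det_2 trace_2 algebra_simps)
  show "mat (trace M) - M \<in> carrier SL2"
    using assms by (simp add: mat_def det_2 trace_2 algebra_simps)
qed (use assms in simp)

lemma SL2_tuplesD: "A \<in> SL2_tuples k \<Longrightarrow> i \<in> {1..k} \<Longrightarrow> det (A i) = 1"
  by (auto simp: SL2_tuples_def)

section \<open>Algebras of functions\<close>

text \<open>One interface for all sets of functions used later: the regular ring, the coordinate
  ring, a generated subalgebra, and the rational and the algebraic elements.\<close>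

locale function_algebra =
  fixes k :: nat and C :: "((nat \<Rightarrow> 'a::field ^ 2 ^ 2) \<Rightarrow> 'a) set"
  assumes const: "(\<lambda>A\<in>SL2_tuples k. c) \<in> C"
    and add: "f \<in> C \<Longrightarrow> g \<in> C \<Longrightarrow> (\<lambda>A\<in>SL2_tuples k. f A + g A) \<in> C"
    and mult: "f \<in> C \<Longrightarrow> g \<in> C \<Longrightarrow> (\<lambda>A\<in>SL2_tuples k. f A * g A) \<in> C"
begin

text \<open>Testing membership after restriction lets formulas in \<open>A\<close> be written
  without restricting each subterm and be changed freely off \<open>SL2_tuples k\<close>.\<close>

definition mem :: "((nat \<Rightarrow> 'a ^ 2 ^ 2) \<Rightarrow> 'a) \<Rightarrow> bool"
  where "mem f \<longleftrightarrow> restrict f (SL2_tuples k) \<in> C"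

lemma mem_cong: "(\<And>A. A \<in> SL2_tuples k \<Longrightarrow> f A = g A) \<Longrightarrow> mem f \<longleftrightarrow> mem g"
  unfolding mem_def by (metis restrict_ext)

lemma mem_const: "mem (\<lambda>A. c)"
  by (simp add: mem_def const)

lemma mem_add: "mem f \<Longrightarrow> mem g \<Longrightarrow> mem (\<lambda>A. f A + g A)"
  using add[of "restrict f (SL2_tuples k)" "restrict g (SL2_tuples k)"]
  by (simp add: mem_def cong: restrict_cong)

lemma mem_mult: "mem f \<Longrightarrow> mem g \<Longrightarrow> mem (\<lambda>A. f A * g A)"
  using mult[of "restrict f (SL2_tuples k)" "restrict g (SL2_tuples k)"]
  by (simp add: mem_def cong: restrict_cong)

lemma mem_uminus: "mem f \<Longrightarrow> mem (\<lambda>A. - f A)"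
  using mem_mult[OF mem_const[of "-1"]] by simp

lemma mem_diff: "mem f \<Longrightarrow> mem g \<Longrightarrow> mem (\<lambda>A. f A - g A)"
  using mem_add[OF _ mem_uminus] by simp

lemmas mem_intros = mem_const mem_add mem_mult mem_uminus mem_diff

end

section \<open>Traces of words\<close>

definition word_prod :: "(nat \<Rightarrow> 'a::comm_semiring_1 ^ 2 ^ 2) \<Rightarrow> nat list \<Rightarrow> 'a ^ 2 ^ 2"
  where "word_prod A w = foldr (\<lambda>i. (**) (A i)) w (mat 1)"

lemma word_prod_simps [simp]:
  "word_prod A [] = mat 1" "word_prod A (i # w) = A i ** word_prod A w"
  by (simp_all add: word_prod_def)

lemma word_prod_append: "word_prod A (u @ v) = word_prod A u ** word_prod A v"
  by (induction u) (simp_all add: matrix_mul_assoc)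

lemma trace_word_prod_rotate: "trace (word_prod A (u @ v)) = trace (word_prod A (v @ u))"
  by (simp add: word_prod_append trace_mult_commute)

text \<open>The tail is rearranged first, behind its leading letter, which is then carried to its
  position. The prefix \<open>x\<close> is generalised because letters already passed stay in
  front.\<close>

lemma adjacent_swaps:
  assumes swap: "\<And>x a b y. P (x @ a # b # y) \<Longrightarrow> P (x @ b # a # y)"
    and "mset u = mset v" "P u"
  shows "P v"
proof -
  have shift: "P (x @ a # u @ v) \<Longrightarrow> P (x @ u @ a # v)" for x a u v
  proof (induction u arbitrary: x)
    case (Cons b u)
    then show ?case using swap[of x a b "u @ v"] Cons.IH[of "x @ [b]"] by simp
  qed simp
  have "P (x @ u) \<Longrightarrow> P (x @ v)" if "mset u = mset v" for x u v
    using that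
  proof (induction u arbitrary: x v)
    case (Cons a u)
    then have "a \<in> set v" by (metis list.set_intros(1) mset_eq_setD)
    then obtain v1 v2 where v: "v = v1 @ a # v2" by (meson split_list)
    with Cons.prems have "mset u = mset (v1 @ v2)" by simp
    from Cons.IH[OF _ this, of "x @ [a]"] Cons.prems(1) shift[of x a v1 v2] show ?case
      by (simp add: v)
  qed simp
  from this[where x = "[]" and u = u and v = v] assms(2,3) show ?thesis by simp
qed

lemma two_neq_zero: "CHAR('a::field) \<noteq> 2 \<Longrightarrow> (2 :: 'a) \<noteq> 0"
proof
  assume "CHAR('a) \<noteq> 2" "(2 :: 'a) = 0"
  then have "CHAR('a) dvd 2" using of_nat_eq_0_iff_char_dvd[of 2, where ?'a='a] by simp
  with \<open>CHAR('a) \<noteq> 2\<close> have "CHAR('a) = 1"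
    using two_is_prime_nat by (metis prime_nat_iff)
  then show False using of_nat_eq_0_iff_char_dvd[of 1, where ?'a='a] by simp
qed

context function_algebra
begin

lemma mem_trace_word_prod:
  assumes one: "\<And>i. i \<in> {1..k} \<Longrightarrow> mem (\<lambda>A. trace (A i))"
    and two: "\<And>i j. i \<in> {1..k} \<Longrightarrow> j \<in> {1..k} \<Longrightarrow> i < j \<Longrightarrow> mem (\<lambda>A. trace (A i ** A j))"
    and three: "\<And>i j l. i \<in> {1..k} \<Longrightarrow> j \<in> {1..k} \<Longrightarrow> l \<in> {1..k} \<Longrightarrow> i < j \<Longrightarrow> j < l
      \<Longrightarrow> mem (\<lambda>A. trace (A i ** A j ** A l))"
    and char: "CHAR('a) \<noteq> 2 \<or> k \<le> 3"
    and "set w \<subseteq> {1..k}"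
  shows "mem (\<lambda>A. trace (word_prod A w))"
  using \<open>set w \<subseteq> {1..k}\<close>
proof (induction "length w" arbitrary: w rule: less_induct)
  case less
  let ?t = "\<lambda>u. mem (\<lambda>A. trace (word_prod A u))"
  have IH: "?t u" if "length u < length w" "set u \<subseteq> {1..k}" for u
    using less.hyps[of u] that by simp
  have square: "mem (\<lambda>A. trace (A i ** A i))" if "i \<in> {1..k}" for i
  proof -
    have "mem (\<lambda>A. trace (A i) * trace (A i) - 2)"
      by (intro mem_intros one that)
    then show ?thesis
      using trace_square_SL2[OF SL2_tuplesD[OF _ that]] by (subst mem_cong) auto
  qed
  have pair: "mem (\<lambda>A. trace (A i ** A j))" if "i \<in> {1..k}" "j \<in> {1..k}" for i j
    using two[of i j] two[of j i] square[of i] that trace_mult_commute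
    by (cases i j rule: linorder_cases) (auto simp: trace_mult_commute)
  \<comment> \<open>The guard keeps every word in play a permutation of \<open>w\<close>, so the
    induction hypothesis covers all correction terms of a swap.\<close>
  define P where "P u \<longleftrightarrow> mset u = mset w \<longrightarrow> ?t u" for u
  have rotate: "?t (u @ v) \<longleftrightarrow> ?t (v @ u)" for u v
    by (simp add: trace_word_prod_rotate)
  have swap: "P (x @ a # b # y)" if P: "P (x @ b # a # y)" for x a b y
    unfolding P_def
  proof
    assume mset: "mset (x @ a # b # y) = mset w"
    then have "set (x @ a # b # y) = set w" by (rule mset_eq_setD)
    then have in_range: "a \<in> {1..k}" "b \<in> {1..k}" "set x \<subseteq> {1..k}" "set y \<subseteq> {1..k}"
      using less.prems by auto
    have len: "length x + length y + 2 = length w"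
      using mset_eq_length[OF mset] by simp
    from P mset have "?t (x @ b # a # y)" by (simp add: P_def add_mset_commute)
    \<comment> \<open>Cyclic rotation puts the pair at the front, where \<open>trace_swap\<close>
      applies.\<close>
    then have "mem (\<lambda>A. trace (A b ** A a ** word_prod A (y @ x)))"
      using rotate[of x "b # a # y"] by (simp add: matrix_mul_assoc)
    moreover have "mem (\<lambda>A. trace (A a ** word_prod A (y @ x)))"
      "mem (\<lambda>A. trace (A b ** word_prod A (y @ x)))" "?t (y @ x)"
      using IH[of "a # y @ x"] IH[of "b # y @ x"] IH[of "y @ x"] len in_range by auto
    ultimately have "mem (\<lambda>A. trace (A a ** A b ** word_prod A (y @ x)))"
      unfolding trace_swap[of "_ a"] by (intro mem_intros one pair in_range)
    then show "?t (x @ a # b # y)"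
      using rotate[of x "a # b # y"] by (simp add: matrix_mul_assoc)
  qed
  have perm: "?t w" if "?t u" "mset u = mset w" for u
    using adjacent_swaps[of P u w] swap that by (auto simp: P_def)
  show ?case
  proof (cases "distinct w")
    case False
    then obtain xs ys zs a where w: "w = xs @ [a] @ ys @ [a] @ zs"
      using not_distinct_decomp by blast
    let ?r = "xs @ ys @ zs"
    have "mem (\<lambda>A. trace (A a) * trace (word_prod A (a # ?r)) - trace (word_prod A ?r))"
      using less.prems by (intro mem_intros one IH) (auto simp: w)
    moreover have "a \<in> {1..k}" using less.prems by (simp add: w)
    ultimately have "?t (a # a # ?r)"
      using trace_square[OF SL2_tuplesD[of _ k a]]
      by (subst mem_cong) (auto simp: matrix_mul_assoc)
    then show ?thesis by (rule perm) (simp add: w)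
  next
    case True
    \<comment> \<open>Sorting produces the strictly increasing indices required by
      \<open>two\<close> and \<open>three\<close>.\<close>
    define s where "s = sort w"
    have s: "sorted_wrt (<) s" "set s \<subseteq> {1..k}" "length s = length w"
      using True less.prems by (auto simp: s_def strict_sorted_iff)
    have "?t s"
    proof -
      consider "s = []" | a where "s = [a]" | a b where "s = [a, b]" | a b c where "s = [a, b, c]"
        | a b c d r where "s = a # b # c # d # r"
        by (metis list.exhaust)
      then show ?thesis
      proof cases
        case 1
        then show ?thesis by (simp add: mem_const)
      next
        case 2
        then show ?thesis using one s by simp
      next
        case 3
        then show ?thesis using two s by simp
      next
        case 4
        then show ?thesis using three s by (simp add: matrix_mul_assoc)
      next
        case 5
        \<comment> \<open>Four distinct letters force \<open>k \<ge> 4\<close>, which excludes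
          characteristic 2 and permits halving.\<close>
        have "card {a, b, c, d} \<le> card {1..k}"
          using s by (intro card_mono) (auto simp: 5)
        then have "k \<ge> 4" using s by (auto simp: 5)
        then have "(2 :: 'a) \<noteq> 0" using char two_neq_zero by auto
        have m: "mem (\<lambda>A. trace (word_prod A u))" if "length u < length s" "set u \<subseteq> set s" for u
          using IH[of u] that s by auto
        \<comment> \<open>The whole tail counts as the fourth factor, so one identity serves every
          length from four on.\<close>
        let ?Q = "\<lambda>A. word_prod A (d # r)"
        have "mem (\<lambda>A. trace (A a ** A b ** ?Q A))" "mem (\<lambda>A. trace (A a ** A c ** ?Q A))"
          "mem (\<lambda>A. trace (A b ** A c ** ?Q A))" "mem (\<lambda>A. trace (A a ** A b ** A c))"
          "mem (\<lambda>A. trace (A a ** ?Q A))" "mem (\<lambda>A. trace (A b ** ?Q A))" 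
          "mem (\<lambda>A. trace (A c ** ?Q A))" "mem (\<lambda>A. trace (?Q A))"
          using m[of "a # b # d # r"] m[of "a # c # d # r"] m[of "b # c # d # r"] m[of "[a, b, c]"]
            m[of "a # d # r"] m[of "b # d # r"] m[of "c # d # r"] m[of "d # r"]
          by (auto simp: 5 matrix_mul_assoc)
        moreover have "a \<in> {1..k}" "b \<in> {1..k}" "c \<in> {1..k}" using s by (auto simp: 5)
        ultimately have "mem (\<lambda>A. 2 * trace (A a ** A b ** A c ** ?Q A))"
          unfolding trace_four by (intro mem_intros one pair)
        then have "mem (\<lambda>A. inverse 2 * (2 * trace (A a ** A b ** A c ** ?Q A)))"
          by (rule mem_mult[OF mem_const])
        then show ?thesis
          using \<open>2 \<noteq> 0\<close> by (simp add: 5 matrix_mul_assoc mult.assoc[symmetric])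
      qed
    qed
    then show ?thesis by (rule perm) (simp add: s_def)
  qed
qed

text \<open>The positive prefix \<open>u\<close> absorbs the letters already read: an inverse letter
  becomes its trace minus the letter, and the letter then joins the prefix.\<close>

lemma mem_trace_rep:
  assumes pos: "\<And>u. set u \<subseteq> {1..k} \<Longrightarrow> mem (\<lambda>A. trace (word_prod A u))"
    and "set w \<subseteq> {1..k} \<times> UNIV" "set u \<subseteq> {1..k}"
  shows "mem (\<lambda>A. trace (word_prod A u ** rep A w))"
  using assms(2,3)
proof (induction w arbitrary: u)
  case Nil
  then show ?case using pos by (simp add: rep_def)
next
  case (Cons a w)
  obtain i b where a: "a = (i, b)" by fastforce
  have i: "i \<in> {1..k}" using Cons.prems by (simp add: a)
  have IH: "mem (\<lambda>A. trace (word_prod A v ** rep A w))" if "set v \<subseteq> {1..k}" for v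
    using Cons that by simp
  show ?case
  proof (cases b)
    case True
    then show ?thesis
      using IH[of "u @ [i]"] Cons.prems i
      by (simp add: a rep_def letter_value_def word_prod_append matrix_mul_assoc)
  next
    case False
    have "mem (\<lambda>A. trace (A i) * trace (word_prod A u ** rep A w)
      - trace (word_prod A (u @ [i]) ** rep A w))"
      using pos[of "[i]"] Cons.prems i by (intro mem_intros IH) auto
    then show ?thesis
      using False SL2_tuplesD[OF _ i, where ?'a = 'a]
      by (subst mem_cong)
        (auto simp: a rep_def letter_value_def word_prod_append matrix_mul_assoc inv_SL2 trace_adjugate)
  qed
qed

end

section \<open>The coordinate ring\<close>

lemma SL2_tuples_ident: "(\<lambda>i\<in>{1..k}. mat 1) \<in> SL2_tuples k"
  by (auto simp: SL2_tuples_def)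

lemma cring_fun_ring: "cring (fun_ring k :: ((nat \<Rightarrow> 'a::field ^ 2 ^ 2) \<Rightarrow> 'a) ring)"
proof (rule cringI)
  show "abelian_group (fun_ring k :: ((nat \<Rightarrow> 'a ^ 2 ^ 2) \<Rightarrow> 'a) ring)"
  proof (rule abelian_groupI)
    fix f :: "(nat \<Rightarrow> 'a ^ 2 ^ 2) \<Rightarrow> 'a" assume "f \<in> carrier (fun_ring k)"
    then show "\<exists>g\<in>carrier (fun_ring k). g \<oplus>\<^bsub>fun_ring k\<^esub> f = \<zero>\<^bsub>fun_ring k\<^esub>"
      by (intro bexI[of _ "\<lambda>A\<in>SL2_tuples k. - f A"]) (auto simp: fun_ring_def)
  qed (auto simp: fun_ring_def fun_eq_iff PiE_def extensional_def algebra_simps)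
  show "comm_monoid (fun_ring k :: ((nat \<Rightarrow> 'a ^ 2 ^ 2) \<Rightarrow> 'a) ring)"
    by (rule comm_monoidI) (auto simp: fun_ring_def fun_eq_iff PiE_def extensional_def algebra_simps)
qed (auto simp: fun_ring_def fun_eq_iff algebra_simps)

lemma fun_ring_a_inv:
  assumes "f \<in> carrier (fun_ring k)"
  shows "\<ominus>\<^bsub>fun_ring k\<^esub> f = (\<lambda>A\<in>SL2_tuples k. - f A)"
proof -
  interpret cring "fun_ring k :: ((nat \<Rightarrow> 'a ^ 2 ^ 2) \<Rightarrow> 'a) ring" by (rule cring_fun_ring)
  show ?thesis using assms by (intro minus_equality) (auto simp: fun_ring_def)
qed

lemma constants_sub_fun_ring: "constants k \<subseteq> carrier (fun_ring k)"
  by (auto simp: constants_def fun_ring_def)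

lemma entries_sub_fun_ring: "entries k \<subseteq> carrier (fun_ring k)"
  by (auto simp: entries_def fun_ring_def)

lemma regular_ring_simps:
  "f \<oplus>\<^bsub>regular_ring k\<^esub> g = (\<lambda>A\<in>SL2_tuples k. f A + g A)"
  "f \<otimes>\<^bsub>regular_ring k\<^esub> g = (\<lambda>A\<in>SL2_tuples k. f A * g A)"
  by (simp_all add: regular_ring_def fun_ring_def)

lemma coord_ring_simps:
  "f \<oplus>\<^bsub>coord_ring k\<^esub> g = (\<lambda>A\<in>SL2_tuples k. f A + g A)"
  "f \<otimes>\<^bsub>coord_ring k\<^esub> g = (\<lambda>A\<in>SL2_tuples k. f A * g A)"
  "\<one>\<^bsub>coord_ring k\<^esub> = (\<lambda>A\<in>SL2_tuples k. 1)"
  "\<zero>\<^bsub>coord_ring k\<^esub> = (\<lambda>A\<in>SL2_tuples k. 0)"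
  by (simp_all add: coord_ring_def regular_ring_def fun_ring_def)

lemma subring_regular_ring: "subring (carrier (regular_ring k)) (fun_ring k)"
proof -
  interpret cring "fun_ring k :: ((nat \<Rightarrow> 'a ^ 2 ^ 2) \<Rightarrow> 'a) ring" by (rule cring_fun_ring)
  show ?thesis
    unfolding regular_ring_def generated_algebra_def
    using generate_ring_is_subring[OF Un_least[OF constants_sub_fun_ring entries_sub_fun_ring]] by simp
qed

lemma cring_regular_ring: "cring (regular_ring k :: ((nat \<Rightarrow> 'a::field ^ 2 ^ 2) \<Rightarrow> 'a) ring)"
proof -
  interpret cring "fun_ring k :: ((nat \<Rightarrow> 'a ^ 2 ^ 2) \<Rightarrow> 'a) ring" by (rule cring_fun_ring)
  have "cring (fun_ring k \<lparr>carrier := carrier (regular_ring k)\<rparr>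
    :: ((nat \<Rightarrow> 'a ^ 2 ^ 2) \<Rightarrow> 'a) ring)"
    using subcringI'[OF subring_regular_ring] subcring_iff[OF subringE(1)[OF subring_regular_ring]]
    by blast
  then show ?thesis by (simp add: regular_ring_def)
qed

lemma function_algebra_generate:
  fixes R :: "((nat \<Rightarrow> 'a::field ^ 2 ^ 2) \<Rightarrow> 'a, 'b) ring_scheme"
  assumes "\<And>f g. f \<oplus>\<^bsub>R\<^esub> g = (\<lambda>A\<in>SL2_tuples k. f A + g A)"
    and "\<And>f g. f \<otimes>\<^bsub>R\<^esub> g = (\<lambda>A\<in>SL2_tuples k. f A * g A)"
  shows "function_algebra k (generate_ring R (constants k \<union> S))"
proof
  fix c show "(\<lambda>A\<in>SL2_tuples k. c) \<in> generate_ring R (constants k \<union> S)"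
    by (rule generate_ring.incl) (auto simp: constants_def)
qed (metis assms generate_ring.eng_add generate_ring.eng_mult)+

lemma function_algebra_regular_ring: "function_algebra k (carrier (regular_ring k))"
  using function_algebra_generate[of "fun_ring k" k "entries k"]
  by (simp add: regular_ring_def generated_algebra_def fun_ring_def)

text \<open>Inverses are adjugates, so the entries of any word are polynomials in the entries of the
  tuple. This places the generators of the coordinate ring inside the ring in which they
  generate.\<close>

lemma trace_fun_regular:
  assumes "set w \<subseteq> {1..k} \<times> UNIV"
  shows "trace_fun k w \<in> carrier (regular_ring k :: ((nat \<Rightarrow> 'a::field ^ 2 ^ 2) \<Rightarrow> 'a) ring)"
proof -
  interpret function_algebra k "carrier (regular_ring k :: ((nat \<Rightarrow> 'a ^ 2 ^ 2) \<Rightarrow> 'a) ring)"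
    by (rule function_algebra_regular_ring)
  have entry: "mem (\<lambda>A. A i $ r $ s)" if "i \<in> {1..k}" for i r s
    unfolding mem_def unfolding regular_ring_def generated_algebra_def
    using that by (auto simp: entries_def intro!: generate_ring.incl)
  have letter: "mem (\<lambda>A. letter_value A a $ r $ s)" if "fst a \<in> {1..k}" for a r s
  proof (cases "snd a")
    case True
    then show ?thesis using entry that by (simp add: letter_value_def)
  next
    case False
    have "mem (\<lambda>A. (mat (trace (A (fst a))) - A (fst a)) $ r $ s)"
      by (cases "r = s") (auto simp: mat_def trace_2 intro!: mem_intros entry that)
    then show ?thesis
      using False SL2_tuplesD[OF _ that, where ?'a = 'a]
      by (subst mem_cong) (auto simp: letter_value_def inv_SL2)
  qed
  have rep: "mem (\<lambda>A. rep A w $ r $ s)" for r s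
    using assms
  proof (induction w arbitrary: r s)
    case Nil
    then show ?case by (simp add: rep_def mem_const)
  next
    case (Cons a w)
    have "mem (\<lambda>A. letter_value A a $ r $ 1 * rep A w $ 1 $ s + letter_value A a $ r $ 2 * rep A w $ 2 $ s)"
      using Cons by (intro mem_intros letter) auto
    then show ?case by (simp add: rep_def matrix_mult_2)
  qed
  have "mem (\<lambda>A. trace (rep A w))"
    unfolding trace_2 by (intro mem_intros rep)
  then show ?thesis by (simp add: mem_def trace_fun_def character_def)
qed

lemma coord_ring_generators:
  "constants k \<union> trace_fun k ` carrier (free_group k) \<subseteq> carrier (regular_ring k)"
proof -
  interpret function_algebra k "carrier (regular_ring k)" by (rule function_algebra_regular_ring)
  show ?thesis
    using const trace_fun_regular by (auto simp: constants_def free_group_def)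
qed

lemma subring_coord_ring: "subring (carrier (coord_ring k)) (regular_ring k)"
proof -
  interpret cring "regular_ring k :: ((nat \<Rightarrow> 'a ^ 2 ^ 2) \<Rightarrow> 'a) ring" by (rule cring_regular_ring)
  show ?thesis
    unfolding coord_ring_def generated_algebra_def
    using generate_ring_is_subring[OF coord_ring_generators] by simp
qed

lemma cring_coord_ring: "cring (coord_ring k :: ((nat \<Rightarrow> 'a::field ^ 2 ^ 2) \<Rightarrow> 'a) ring)"
proof -
  interpret cring "regular_ring k :: ((nat \<Rightarrow> 'a ^ 2 ^ 2) \<Rightarrow> 'a) ring" by (rule cring_regular_ring)
  have "cring (regular_ring k \<lparr>carrier := carrier (coord_ring k)\<rparr>
    :: ((nat \<Rightarrow> 'a ^ 2 ^ 2) \<Rightarrow> 'a) ring)"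
    using subcringI'[OF subring_coord_ring] subcring_iff[OF subringE(1)[OF subring_coord_ring]]
    by blast
  then show ?thesis by (simp add: coord_ring_def)
qed

lemma carrier_coord_ring:
  "carrier (coord_ring k) = generate_ring (regular_ring k) (constants k \<union> trace_fun k ` carrier (free_group k))"
  by (simp add: coord_ring_def generated_algebra_def)

lemma coord_ring_sub_regular: "carrier (coord_ring k) \<subseteq> carrier (regular_ring k)"
  using subringE(1)[OF subring_coord_ring] .

lemma function_algebra_coord_ring: "function_algebra k (carrier (coord_ring k))"
  unfolding carrier_coord_ring
  by (rule function_algebra_generate) (simp_all add: regular_ring_simps)

lemma regular_ring_extensional:
  "f \<in> carrier (regular_ring k) \<Longrightarrow> restrict f (SL2_tuples k) = f"
  using subringE(1)[OF subring_regular_ring] by (fastforce simp: fun_ring_def extensional_restrict PiE_def)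

lemma trace_fun_in_coord_ring: "w \<in> carrier (free_group k) \<Longrightarrow> trace_fun k w \<in> carrier (coord_ring k)"
  unfolding carrier_coord_ring by (rule generate_ring.incl) blast

subsection \<open>Irreducibility\<close>

text \<open>Every matrix of \<open>SL\<^sub>2\<close> is a product of four elementary matrices. Interpolating their
  parameters linearly joins any two points of \<open>(SL\<^sub>2)\<^sup>k\<close> by a polynomial curve, along which regular
  functions restrict to polynomials in one variable.\<close>

definition upper_elem :: "'a::comm_ring_1 \<Rightarrow> 'a ^ 2 ^ 2"
  where "upper_elem x = vector [vector [1, x], vector [0, 1]]"

definition lower_elem :: "'a::comm_ring_1 \<Rightarrow> 'a ^ 2 ^ 2"
  where "lower_elem x = vector [vector [1, 0], vector [x, 1]]"

definition elem_prod :: "'a::comm_ring_1 \<Rightarrow> 'a \<Rightarrow> 'a \<Rightarrow> 'a \<Rightarrow> 'a ^ 2 ^ 2"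
  where "elem_prod x y z w = upper_elem x ** lower_elem y ** upper_elem z ** lower_elem w"

lemmas elem_prod_entries = elem_prod_def upper_elem_def lower_elem_def matrix_mult_2 vector_2

text \<open>Three factors reach every matrix whose lower left entry is nonzero; a further lower
  factor on the right arranges this and is undone at the end.\<close>

lemma SL2_elem_prod:
  fixes M :: "'a::field ^ 2 ^ 2"
  assumes "det M = 1"
  shows "\<exists>x y z w. M = elem_prod x y z w"
proof -
  have ex: "\<exists>x y z. N = upper_elem x ** lower_elem y ** upper_elem z"
    if "det N = 1" "N $ 2 $ 1 \<noteq> 0" for N :: "'a ^ 2 ^ 2"
  proof -
    have "N $ 1 $ 1 * N $ 2 $ 2 = 1 + N $ 1 $ 2 * N $ 2 $ 1"
      using that by (simp add: det_2 algebra_simps)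
    \<comment> \<open>\<open>upper_elem x ** lower_elem y ** upper_elem z\<close> has lower left
      entry \<open>y\<close> and diagonal \<open>1 + x * y\<close>, \<open>1 + y * z\<close>, which
      fixes the parameters; the determinant settles the remaining entry.\<close>
    with that have
      "N = upper_elem ((N$1$1 - 1) / N$2$1) ** lower_elem (N$2$1) ** upper_elem ((N$2$2 - 1) / N$2$1)"
      by (simp add: vec_eq_iff forall_2 elem_prod_entries field_simps)
    then show ?thesis by blast
  qed
  obtain w where w: "(M ** lower_elem w) $ 2 $ 1 \<noteq> 0"
  proof (cases "M $ 2 $ 1 = 0")
    case True
    then have "M $ 2 $ 2 \<noteq> 0" using assms by (auto simp: det_2)
    with True have "(M ** lower_elem 1) $ 2 $ 1 \<noteq> 0" by (simp add: elem_prod_entries)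
    then show ?thesis by (rule that)
  next
    case False
    then have "(M ** lower_elem 0) $ 2 $ 1 \<noteq> 0" by (simp add: elem_prod_entries)
    then show ?thesis by (rule that)
  qed
  have "det (lower_elem w) = 1" by (simp add: det_2 lower_elem_def)
  then obtain x y z where "M ** lower_elem w = upper_elem x ** lower_elem y ** upper_elem z"
    using ex[OF _ w] assms by (auto simp: det_mul)
  then have "M ** lower_elem w ** lower_elem (-w) = elem_prod x y z (-w)"
    by (simp add: elem_prod_def)
  moreover have "lower_elem w ** lower_elem (-w) = mat 1"
    by (simp add: vec_eq_iff forall_2 elem_prod_entries mat_def)
  ultimately have "M = elem_prod x y z (-w)"
    by (simp add: matrix_mul_assoc[symmetric])
  then show ?thesis by blast
qed

lemma det_elem_prod: "det (elem_prod x y z w) = 1"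
  by (simp add: elem_prod_def det_mul) (simp add: det_2 upper_elem_def lower_elem_def)

lemma SL2_polynomial_curve:
  fixes A B :: "nat \<Rightarrow> 'a::field ^ 2 ^ 2"
  assumes "A \<in> SL2_tuples k" "B \<in> SL2_tuples k"
  obtains \<gamma> where "\<And>t. \<gamma> t \<in> SL2_tuples k" "\<gamma> 0 = A" "\<gamma> 1 = B"
    "\<And>i r s. i \<in> {1..k} \<Longrightarrow> \<exists>p. \<forall>t. \<gamma> t i $ r $ s = poly p t"
proof -
  have "\<exists>x y z w x' y' z' w'. A i = elem_prod x y z w \<and> B i = elem_prod x' y' z' w'" if "i \<in> {1..k}" for i
    using SL2_elem_prod[OF SL2_tuplesD[OF assms(1) that]] SL2_elem_prod[OF SL2_tuplesD[OF assms(2) that]]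
    by metis
  then obtain x y z w x' y' z' w' where
    A: "\<And>i. i \<in> {1..k} \<Longrightarrow> A i = elem_prod (x i) (y i) (z i) (w i)" and
    B: "\<And>i. i \<in> {1..k} \<Longrightarrow> B i = elem_prod (x' i) (y' i) (z' i) (w' i)"
    by metis
  define \<gamma> where "\<gamma> t = (\<lambda>i\<in>{1..k}. elem_prod (x i + t * (x' i - x i)) (y i + t * (y' i - y i))
    (z i + t * (z' i - z i)) (w i + t * (w' i - w i)))" for t
  show thesis
  proof (rule that[of \<gamma>])
    show "\<gamma> t \<in> SL2_tuples k" for t
      by (auto simp: SL2_tuples_def \<gamma>_def det_elem_prod)
    show "\<gamma> 0 = A" "\<gamma> 1 = B"
      using assms A B by (auto simp: \<gamma>_def SL2_tuples_def PiE_def extensional_def fun_eq_iff)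
    fix i and r s :: 2 assume i: "i \<in> {1..k}"
    \<comment> \<open>The polynomial is an entry of the same product formed over the polynomial
      ring, which is why \<open>elem_prod\<close> lives over commutative rings.\<close>
    have "\<gamma> t i $ r $ s = poly (elem_prod [:x i, x' i - x i:] [:y i, y' i - y i:]
      [:z i, z' i - z i:] [:w i, w' i - w i:] $ r $ s) t" for t
      using i exhaust_2[of r] exhaust_2[of s] by (auto simp: \<gamma>_def elem_prod_entries algebra_simps)
    then show "\<exists>p. \<forall>t. \<gamma> t i $ r $ s = poly p t" by blast
  qed
qed

lemma regular_along_curve:
  fixes f :: "(nat \<Rightarrow> 'a::field ^ 2 ^ 2) \<Rightarrow> 'a"
  assumes "f \<in> carrier (regular_ring k)"
    and \<gamma>: "\<And>t. \<gamma> t \<in> SL2_tuples k" "\<And>i r s. i \<in> {1..k} \<Longrightarrow> \<exists>p. \<forall>t. \<gamma> t i $ r $ s = poly p t"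
  shows "\<exists>p. \<forall>t. f (\<gamma> t) = poly p t"
proof -
  interpret cring "fun_ring k :: ((nat \<Rightarrow> 'a ^ 2 ^ 2) \<Rightarrow> 'a) ring" by (rule cring_fun_ring)
  have "f \<in> generate_ring (fun_ring k) (constants k \<union> entries k)"
    using assms(1) by (simp add: regular_ring_def generated_algebra_def)
  then show ?thesis
  proof induction
    case one
    then show ?case using \<gamma>(1) by (auto simp: fun_ring_def intro: exI[of _ 1])
  next
    case (incl h)
    then consider c where "h = (\<lambda>A\<in>SL2_tuples k. c)" 
      | i r s where "h = (\<lambda>A\<in>SL2_tuples k. A i $ r $ s)" "i \<in> {1..k}"
      by (auto simp: constants_def entries_def)
    then show ?case
    proof cases
      case 1
      then show ?thesis using \<gamma>(1) by (auto intro: exI[of _ "[:c:]"])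
    next
      case 2
      then show ?thesis using \<gamma> by simp
    qed
  next
    case (a_inv h)
    then have "h \<in> carrier (fun_ring k)"
      using generate_ring_in_carrier[of "constants k \<union> entries k"]
        constants_sub_fun_ring entries_sub_fun_ring by blast
    moreover from a_inv obtain p where "\<forall>t. h (\<gamma> t) = poly p t" by blast
    ultimately show ?case using \<gamma>(1) by (intro exI[of _ "-p"]) (simp add: fun_ring_a_inv)
  next
    case (eng_add h1 h2)
    then obtain p q where "\<forall>t. h1 (\<gamma> t) = poly p t" "\<forall>t. h2 (\<gamma> t) = poly q t" by blast
    then show ?case using \<gamma>(1) by (intro exI[of _ "p + q"]) (simp add: fun_ring_def)
  next
    case (eng_mult h1 h2)
    then obtain p q where "\<forall>t. h1 (\<gamma> t) = poly p t" "\<forall>t. h2 (\<gamma> t) = poly q t" by blast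
    then show ?case using \<gamma>(1) by (intro exI[of _ "p * q"]) (simp add: fun_ring_def)
  qed
qed

text \<open>Over a finite field, 1 plus the product of all \<open>[:-a, 1:]\<close> would be
  nonconstant and take the value 1 everywhere.\<close>

lemma infinite_alg_closed_field: "infinite (UNIV :: 'a::alg_closed_field set)"
proof
  assume fin: "finite (UNIV :: 'a set)"
  define p where "p = (\<Prod>a\<in>(UNIV::'a set). [:-a, 1:]) + 1"
  have "Polynomial.degree (\<Prod>a\<in>(UNIV::'a set). [:-a, 1:]) = card (UNIV :: 'a set)"
    by (subst degree_prod_sum_eq) auto
  moreover have "card (UNIV :: 'a set) > 0" using fin by (simp add: card_gt_0_iff)
  ultimately have "Polynomial.degree p > 0" by (simp add: p_def degree_add_eq_left)
  then obtain x where "poly p x = 0" using alg_closed_imp_poly_has_root by blast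
  moreover have "poly (\<Prod>a\<in>(UNIV::'a set). [:-a, 1:]) x = 0"
    using fin by (auto simp: poly_prod)
  ultimately show False by (simp add: p_def)
qed

lemma poly_eq_0_cofinite:
  fixes p :: "'a::field poly"
  assumes "infinite (UNIV :: 'a set)" "finite B" "\<And>x. x \<notin> B \<Longrightarrow> poly p x = 0"
  shows "p = 0"
proof (rule ccontr)
  assume "p \<noteq> 0"
  then have "finite ({x. poly p x = 0} \<union> B)" using assms(2) poly_roots_finite by blast
  moreover have "{x. poly p x = 0} \<union> B = UNIV" using assms(3) by blast
  ultimately show False using assms(1) by simp
qed

text \<open>If \<open>f\<close> is nonzero at \<open>A\<close> and \<open>g\<close> at
  \<open>B\<close>, both restrict to nonzero polynomials on a curve through the two points, and so
  does their product.\<close>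

lemma domain_coord_ring: "domain (coord_ring k :: ((nat \<Rightarrow> 'a::alg_closed_field ^ 2 ^ 2) \<Rightarrow> 'a) ring)"
proof (rule domainI)
  show "cring (coord_ring k :: ((nat \<Rightarrow> 'a ^ 2 ^ 2) \<Rightarrow> 'a) ring)" by (rule cring_coord_ring)
  show "\<one>\<^bsub>coord_ring k\<^esub> \<noteq> (\<zero>\<^bsub>coord_ring k\<^esub> :: (nat \<Rightarrow> 'a ^ 2 ^ 2) \<Rightarrow> 'a)"
    using SL2_tuples_ident by (metis coord_ring_simps(3,4) restrict_apply' zero_neq_one)
  fix f g :: "(nat \<Rightarrow> 'a ^ 2 ^ 2) \<Rightarrow> 'a"
  assume fg: "f \<otimes>\<^bsub>coord_ring k\<^esub> g = \<zero>\<^bsub>coord_ring k\<^esub>"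
    and C: "f \<in> carrier (coord_ring k)" "g \<in> carrier (coord_ring k)"
  note R = subsetD[OF coord_ring_sub_regular C(1)] subsetD[OF coord_ring_sub_regular C(2)]
  have nz: "\<exists>A\<in>SL2_tuples k. h A \<noteq> 0" if "h \<noteq> \<zero>\<^bsub>coord_ring k\<^esub>" "h \<in> carrier (regular_ring k)"
    for h :: "(nat \<Rightarrow> 'a ^ 2 ^ 2) \<Rightarrow> 'a"
    using that(1) regular_ring_extensional[OF that(2)] by (metis coord_ring_simps(4) restrict_ext)
  show "f = \<zero>\<^bsub>coord_ring k\<^esub> \<or> g = \<zero>\<^bsub>coord_ring k\<^esub>"
  proof (rule ccontr)
    assume "\<not> ?thesis"
    then obtain A B where A: "A \<in> SL2_tuples k" "f A \<noteq> 0" and B: "B \<in> SL2_tuples k" "g B \<noteq> 0"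
      using nz R by blast
    obtain \<gamma> where \<gamma>: "\<And>t. \<gamma> t \<in> SL2_tuples k" "\<gamma> 0 = A" "\<gamma> 1 = B"
      "\<And>i r s. i \<in> {1..k} \<Longrightarrow> \<exists>p. \<forall>t. \<gamma> t i $ r $ s = poly p t"
      using SL2_polynomial_curve[OF A(1) B(1)] by blast
    obtain p q where pq: "\<And>t. f (\<gamma> t) = poly p t" "\<And>t. g (\<gamma> t) = poly q t"
      using regular_along_curve[OF R(1) \<gamma>(1,4)] regular_along_curve[OF R(2) \<gamma>(1,4)] by blast
    have "poly (p * q) t = 0" for t
      using fun_cong[OF fg, of "\<gamma> t"] \<gamma>(1) by (simp add: coord_ring_simps pq[symmetric])
    then have "p * q = 0" using poly_eq_0_cofinite[OF infinite_alg_closed_field, of "{}"] by blast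
    then have "p = 0 \<or> q = 0" by simp
    then show False using A(2) B(2) pq \<gamma>(2,3) by (metis poly_0)
  qed
qed

section \<open>Minimality of the coordinate ring and traces of unreduced words\<close>

lemma regular_ring_a_inv:
  assumes "f \<in> carrier (regular_ring k)"
  shows "\<ominus>\<^bsub>regular_ring k\<^esub> f = (\<lambda>A\<in>SL2_tuples k. - 1 * f A)"
proof -
  interpret cring "regular_ring k :: ((nat \<Rightarrow> 'a ^ 2 ^ 2) \<Rightarrow> 'a) ring" by (rule cring_regular_ring)
  interpret function_algebra k "carrier (regular_ring k :: ((nat \<Rightarrow> 'a ^ 2 ^ 2) \<Rightarrow> 'a) ring)"
    by (rule function_algebra_regular_ring)
  have "(\<lambda>A\<in>SL2_tuples k. - 1 * f A) \<in> carrier (regular_ring k)"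
    using mult[OF const[of "-1"] assms] by (simp cong: restrict_cong)
  then show ?thesis
    using assms by (intro minus_equality) (auto simp: regular_ring_def fun_ring_def)
qed

text \<open>The common induction principle: \<open>T\<close> will be the subalgebra of the proposed
  generators for one half of the result and the set of algebraic elements for the other.\<close>

lemma coord_ring_least:
  fixes T :: "((nat \<Rightarrow> 'a::field ^ 2 ^ 2) \<Rightarrow> 'a) set"
  assumes "function_algebra k T"
    and traces: "\<And>w. w \<in> carrier (free_group k) \<Longrightarrow> trace_fun k w \<in> T"
  shows "carrier (coord_ring k) \<subseteq> T"
proof
  interpret T: function_algebra k T by fact
  interpret cring "regular_ring k :: ((nat \<Rightarrow> 'a ^ 2 ^ 2) \<Rightarrow> 'a) ring" by (rule cring_regular_ring)
  fix f :: "(nat \<Rightarrow> 'a ^ 2 ^ 2) \<Rightarrow> 'a" assume "f \<in> carrier (coord_ring k)"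
  then show "f \<in> T"
    unfolding carrier_coord_ring
  proof induction
    case one
    then show ?case using T.const[of 1] by (simp add: regular_ring_def fun_ring_def restrict_def)
  next
    case (incl h)
    then show ?case using T.const traces by (auto simp: constants_def)
  next
    case (a_inv h)
    then have "h \<in> carrier (regular_ring k)"
      using generate_ring_in_carrier[OF coord_ring_generators] by blast
    then show ?case
      using T.mult[OF T.const[of "-1"] a_inv.IH] by (simp add: regular_ring_a_inv restrict_def cong: if_cong)
  next
    case (eng_add h1 h2)
    then show ?case using T.add by (simp add: regular_ring_simps restrict_def)
  next
    case (eng_mult h1 h2)
    then show ?case using T.mult by (simp add: regular_ring_simps restrict_def)
  qed
qed

lemma rep_Cons: "rep A (a # w) = letter_value A a ** rep A w"
  by (simp add: rep_def)

lemma rep_append: "rep A (u @ v) = rep A u ** rep A v"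
  by (induction u) (simp_all add: rep_Cons matrix_mul_assoc, simp add: rep_def)

lemma rep_reduce:
  fixes A :: "nat \<Rightarrow> 'a::field ^ 2 ^ 2"
  assumes A: "A \<in> SL2_tuples k" and "set w \<subseteq> {1..k} \<times> UNIV"
  shows "rep A (foldr red_cons w []) = rep A w"
  using assms(2)
proof (induction w)
  case (Cons a w)
  have "[a] \<in> carrier (free_group k)" "foldr red_cons w [] \<in> carrier (free_group k)"
    using Cons.prems set_foldr_red_cons[of w "[]"]
    by (auto simp: free_group_def reduced_Cons reduced_foldr)
  from hom_mult[OF rep_hom(1)[OF A] this] Cons show ?case
    by (simp add: free_group_def rep_Cons) (simp add: rep_def)
qed simp

text \<open>Group elements are reduced words, but concatenation yields unreduced ones; this admits
  all words, so later arguments need not track cancellation.\<close>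

lemma trace_rep_in_coord_ring:
  assumes "set w \<subseteq> {1..k} \<times> UNIV"
  shows "(\<lambda>A\<in>SL2_tuples k. trace (rep A w)) \<in> carrier (coord_ring k :: ((nat \<Rightarrow> 'a::field ^ 2 ^ 2) \<Rightarrow> 'a) ring)"
proof -
  have "foldr red_cons w [] \<in> carrier (free_group k)"
    using assms set_foldr_red_cons[of w "[]"] by (auto simp: free_group_def reduced_foldr)
  from trace_fun_in_coord_ring[OF this, where ?'a = 'a] show ?thesis
    using rep_reduce[OF _ assms, where ?'a = 'a] by (simp add: trace_fun_def character_def cong: restrict_cong)
qed

section \<open>Vanishing of polynomials\<close>

lemma prod_mset_fun_upd:
  fixes v :: "'s \<Rightarrow> 'a::comm_semiring_1"
  shows "(\<Prod>s\<in>#m. (v(z := t)) s) = (\<Prod>s\<in>#filter_mset (\<lambda>s. s \<noteq> z) m. v s) * t ^ count m z"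
  by (induction m) (auto simp: algebra_simps)

text \<open>Variables are split off one at a time. With the others fixed, the sum is a polynomial in
  \<open>z\<close> vanishing on an infinite field, and its coefficient at exponent \<open>n\<close>
  is a sum of the same kind over fewer variables.\<close>

lemma mpoly_zero_coeffs:
  fixes c :: "'s multiset \<Rightarrow> 'a::field"
  assumes inf: "infinite (UNIV :: 'a set)" and "finite S" "finite M"
    and "\<And>m. m \<in> M \<Longrightarrow> set_mset m \<subseteq> S"
    and "\<And>v. (\<Sum>m\<in>M. c m * (\<Prod>s\<in>#m. v s)) = 0"
    and "m \<in> M"
  shows "c m = 0"
  using assms(2-)
proof (induction S arbitrary: M c m rule: finite_induct)
  case empty
  then have "M = {{#}}" "m = {#}" by auto
  with empty show ?case by simp
next
  case (insert z S)
  let ?r = "filter_mset (\<lambda>s. s \<noteq> z)"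
  define n where "n = count m z"
  define N where "N = {m \<in> M. count m z = n}"
  have split: "m = ?r m + replicate_mset n z" if "m \<in> N" for m
    using that multiset_partition[of m "\<lambda>s. s \<noteq> z"] filter_eq_replicate_mset[of z m]
    by (simp add: N_def)
  have inj: "inj_on ?r N"
    by (rule inj_onI) (metis split)
  \<comment> \<open>Within \<open>N\<close> a monomial is determined by its \<open>z\<close>-free
    part, so coefficients can be reindexed by that part.\<close>
  define c' where "c' m = c (m + replicate_mset n z)" for m
  have "c' (?r m) = 0"
  proof (rule insert.IH)
    show "finite (?r ` N)" using insert.prems(1) by (simp add: N_def)
    show "?r m \<in> ?r ` N" using insert.prems by (simp add: N_def n_def)
    show "set_mset u \<subseteq> S" if "u \<in> ?r ` N" for u
      using that insert.prems(2) by (fastforce simp: N_def)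
    fix v :: "'s \<Rightarrow> 'a"
    define q where "q = (\<Sum>m\<in>M. Polynomial.monom (c m * (\<Prod>s\<in>#?r m. v s)) (count m z))"
    have "poly q t = (\<Sum>m\<in>M. c m * (\<Prod>s\<in>#m. (v(z := t)) s))" for t
      by (simp add: q_def poly_sum poly_monom mult.assoc prod_mset_fun_upd del: fun_upd_apply)
    then have "q = 0"
      using insert.prems(3) by (intro poly_eq_0_cofinite[OF inf, of "{}"]) auto
    then have "Polynomial.coeff q n = 0" by simp
    also have "Polynomial.coeff q n = (\<Sum>m\<in>M. if count m z = n then c m * (\<Prod>s\<in>#?r m. v s) else 0)"
      by (simp add: q_def coeff_sum if_distrib cong: if_cong)
    also have "\<dots> = (\<Sum>m\<in>N. c m * (\<Prod>s\<in>#?r m. v s))"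
      unfolding N_def using insert.prems(1) by (simp add: sum.inter_filter)
    also have "\<dots> = (\<Sum>m\<in>N. c' (?r m) * (\<Prod>s\<in>#?r m. v s))"
      using split by (intro sum.cong) (auto simp: c'_def)
    also have "\<dots> = (\<Sum>u\<in>?r ` N. c' u * (\<Prod>s\<in>#u. v s))"
      by (simp add: sum.reindex[OF inj])
    finally show "(\<Sum>u\<in>?r ` N. c' u * (\<Prod>s\<in>#u. v s)) = 0" .
  qed
  moreover have "m \<in> N" using insert.prems by (simp add: N_def n_def)
  ultimately show ?case using split[of m] by (simp add: c'_def)
qed

lemma coord_ring_pow_eval:
  assumes "A \<in> SL2_tuples k"
  shows "(f [^]\<^bsub>coord_ring k\<^esub> (n::nat)) A = f A ^ n"
proof (induction n)
  case 0
  then show ?case using assms by (simp add: nat_pow_def coord_ring_simps)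
next
  case (Suc n)
  then show ?case using assms by (simp add: nat_pow_def coord_ring_simps)
qed

lemma coord_ring_finprod_eval:
  fixes f :: "'i \<Rightarrow> (nat \<Rightarrow> 'a::field ^ 2 ^ 2) \<Rightarrow> 'a"
  assumes "finite I" "f \<in> I \<rightarrow> carrier (coord_ring k)" "A \<in> SL2_tuples k"
  shows "(\<Otimes>\<^bsub>coord_ring k\<^esub>i\<in>I. f i) A = (\<Prod>i\<in>I. f i A)"
proof -
  interpret cring "coord_ring k :: ((nat \<Rightarrow> 'a ^ 2 ^ 2) \<Rightarrow> 'a) ring" by (rule cring_coord_ring)
  show ?thesis
    using assms(1,2)
  proof (induction I)
    case empty
    then show ?case using assms(3) by (simp add: coord_ring_simps)
  next
    case (insert i I)
    then have "(\<Otimes>\<^bsub>coord_ring k\<^esub>i\<in>insert i I. f i) = f i \<otimes>\<^bsub>coord_ring k\<^esub> (\<Otimes>\<^bsub>coord_ring k\<^esub>i\<in>I. f i)"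
      by (intro finprod_insert) auto
    with insert show ?case using assms(3) by (simp add: coord_ring_simps Pi_iff)
  qed
qed

lemma coord_ring_finsum_eval:
  fixes f :: "'i \<Rightarrow> (nat \<Rightarrow> 'a::field ^ 2 ^ 2) \<Rightarrow> 'a"
  assumes "finite I" "f \<in> I \<rightarrow> carrier (coord_ring k)" "A \<in> SL2_tuples k"
  shows "(\<Oplus>\<^bsub>coord_ring k\<^esub>i\<in>I. f i) A = (\<Sum>i\<in>I. f i A)"
proof -
  interpret cring "coord_ring k :: ((nat \<Rightarrow> 'a ^ 2 ^ 2) \<Rightarrow> 'a) ring" by (rule cring_coord_ring)
  show ?thesis
    using assms(1,2)
  proof (induction I)
    case empty
    then show ?case using assms(3) by (simp add: coord_ring_simps)
  next
    case (insert i I)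
    then have "(\<Oplus>\<^bsub>coord_ring k\<^esub>i\<in>insert i I. f i) = f i \<oplus>\<^bsub>coord_ring k\<^esub> (\<Oplus>\<^bsub>coord_ring k\<^esub>i\<in>I. f i)"
      by (intro finsum_insert) auto
    with insert show ?case using assms(3) by (simp add: coord_ring_simps Pi_iff)
  qed
qed

text \<open>\<open>indexed_pset\<close> is an inductive closure; its members must be seen to have
  finite support before they can be evaluated as finite sums.\<close>

lemma indexed_pset_support:
  assumes "ring R" "p \<in> ring.indexed_pset R S K" "\<zero>\<^bsub>R\<^esub> \<in> K" 
    "\<And>a b. a \<in> K \<Longrightarrow> b \<in> K \<Longrightarrow> a \<oplus>\<^bsub>R\<^esub> b \<in> K"
  shows "finite {m. p m \<noteq> \<zero>\<^bsub>R\<^esub>} \<and> (\<forall>m. p m \<in> K) \<and> (\<forall>m. p m \<noteq> \<zero>\<^bsub>R\<^esub> \<longrightarrow> set_mset m \<subseteq> S)"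
proof -
  interpret ring R by fact
  show ?thesis
    using assms(2)
  proof induction
    case (indexed_const c)
    have "{m. indexed_const c m \<noteq> \<zero>\<^bsub>R\<^esub>} \<subseteq> {{#}}" by (auto simp: indexed_const_def)
    then show ?case using indexed_const assms(3) finite_subset
      by (auto simp: indexed_const_def)
  next
    case (indexed_padd P Q)
    have "{m. indexed_padd P Q m \<noteq> \<zero>\<^bsub>R\<^esub>} \<subseteq> {m. P m \<noteq> \<zero>\<^bsub>R\<^esub>} \<union> {m. Q m \<noteq> \<zero>\<^bsub>R\<^esub>}"
      by (auto simp: indexed_padd_def)
    moreover from this have "\<forall>m. indexed_padd P Q m \<noteq> \<zero>\<^bsub>R\<^esub> \<longrightarrow> set_mset m \<subseteq> S"
      using indexed_padd.IH by blast
    ultimately show ?case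
      using indexed_padd.IH assms(4) finite_subset[of _ "{m. P m \<noteq> \<zero>\<^bsub>R\<^esub>} \<union> {m. Q m \<noteq> \<zero>\<^bsub>R\<^esub>}"]
      by (auto simp: indexed_padd_def)
  next
    case (indexed_pmult P i)
    have sub: "{m. indexed_pmult P i m \<noteq> \<zero>\<^bsub>R\<^esub>} \<subseteq> add_mset i ` {m. P m \<noteq> \<zero>\<^bsub>R\<^esub>}"
    proof
      fix m assume "m \<in> {m. indexed_pmult P i m \<noteq> \<zero>\<^bsub>R\<^esub>}"
      then have "i \<in># m" "P (m - {#i#}) \<noteq> \<zero>\<^bsub>R\<^esub>" by (auto simp: indexed_pmult_def split: if_splits)
      then show "m \<in> add_mset i ` {m. P m \<noteq> \<zero>\<^bsub>R\<^esub>}" by (intro image_eqI[of _ _ "m - {#i#}"]) auto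
    qed
    then have "finite {m. indexed_pmult P i m \<noteq> \<zero>\<^bsub>R\<^esub>}"
      using indexed_pmult.IH finite_subset by blast
    moreover have "set_mset m \<subseteq> S" if "indexed_pmult P i m \<noteq> \<zero>\<^bsub>R\<^esub>" for m
    proof -
      from that sub obtain m' where "m = add_mset i m'" "P m' \<noteq> \<zero>\<^bsub>R\<^esub>" by blast
      then show ?thesis using indexed_pmult by simp
    qed
    ultimately show ?case using indexed_pmult.IH assms(3) by (auto simp: indexed_pmult_def)
  qed
qed

text \<open>Values of \<open>z\<close> in a finite set may be excluded because a nonzero polynomial in one
  variable has finitely many roots.\<close>

lemma algebraically_independent_if_generic:
  fixes S :: "((nat \<Rightarrow> 'a::field ^ 2 ^ 2) \<Rightarrow> 'a) set"
  assumes inf: "infinite (UNIV :: 'a set)"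
    and S: "finite S" "S \<subseteq> carrier (coord_ring k)"
    and generic: "\<And>v. \<exists>B. finite B \<and> (\<forall>t. t \<notin> B \<longrightarrow> (\<exists>A\<in>SL2_tuples k. \<forall>s\<in>S. s A = (v(z := t)) s))"
  shows "algebraically_independent (coord_ring k) (constants k) S"
  unfolding algebraically_independent_def
proof (intro ballI impI allI)
  let ?R = "coord_ring k :: ((nat \<Rightarrow> 'a ^ 2 ^ 2) \<Rightarrow> 'a) ring"
  interpret cring ?R by (rule cring_coord_ring)
  fix p m assume p: "p \<in> indexed_pset S (constants k)" and 0: "poly_value ?R p = \<zero>\<^bsub>?R\<^esub>"
  have "\<zero>\<^bsub>?R\<^esub> \<in> constants k" "\<And>a b. a \<in> constants k \<Longrightarrow> b \<in> constants k \<Longrightarrow> a \<oplus>\<^bsub>?R\<^esub> b \<in> constants k"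
    by (auto simp: constants_def coord_ring_simps cong: restrict_cong)
  note supp = indexed_pset_support[OF ring_axioms p this]
  define M where "M = {m. p m \<noteq> \<zero>\<^bsub>?R\<^esub>}"
  have M: "finite M" "\<And>m. m \<in> M \<Longrightarrow> set_mset m \<subseteq> S" using supp by (auto simp: M_def)
  have "\<exists>c. \<forall>m. p m = (\<lambda>A\<in>SL2_tuples k. c m)"
    using supp by (auto simp: constants_def intro!: choice)
  then obtain c where c: "\<And>m. p m = (\<lambda>A\<in>SL2_tuples k. c m)" by blast
  have pC: "p m \<in> carrier ?R" for m
    unfolding c by (rule function_algebra.const[OF function_algebra_coord_ring])
  have eval_zero: "(\<Sum>m\<in>M. c m * (\<Prod>s\<in>#m. s A)) = 0" if A: "A \<in> SL2_tuples k" for A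
  proof -
    have prod: "(\<lambda>s. s [^]\<^bsub>?R\<^esub> count m s) \<in> set_mset m \<rightarrow> carrier ?R" if "m \<in> M" for m
      using M(2)[OF that] S(2) by auto
    have "(\<Sum>m\<in>M. c m * (\<Prod>s\<in>#m. s A)) =
      (\<Sum>m\<in>M. (p m \<otimes>\<^bsub>?R\<^esub> (\<Otimes>\<^bsub>?R\<^esub>s\<in>set_mset m. s [^]\<^bsub>?R\<^esub> count m s)) A)"
      using A prod by (intro sum.cong refl)
        (simp add: coord_ring_simps(2) c coord_ring_finprod_eval coord_ring_pow_eval
          image_prod_mset_multiplicity)
    also have "\<dots> = (\<Oplus>\<^bsub>?R\<^esub>m\<in>M. p m \<otimes>\<^bsub>?R\<^esub> (\<Otimes>\<^bsub>?R\<^esub>s\<in>set_mset m. s [^]\<^bsub>?R\<^esub> count m s)) A"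
      using M(1) A
      by (intro coord_ring_finsum_eval[symmetric] Pi_I m_closed finprod_closed pC prod)
    also have "\<dots> = poly_value ?R p A" by (simp add: poly_value_def M_def)
    also have "\<dots> = 0" using A by (simp add: 0 coord_ring_simps)
    finally show ?thesis .
  qed
  have all: "(\<Sum>m\<in>M. c m * (\<Prod>s\<in>#m. v s)) = 0" for v
  proof -
    obtain B where B: "finite B" "\<And>t. t \<notin> B \<Longrightarrow> \<exists>A\<in>SL2_tuples k. \<forall>s\<in>S. s A = (v(z := t)) s"
      using generic by blast
    \<comment> \<open>The relation as a polynomial in the value \<open>t\<close> of
      \<open>z\<close>, all other values being those of \<open>v\<close>.\<close>
    define q where "q = (\<Sum>m\<in>M. Polynomial.monom (c m * (\<Prod>s\<in>#filter_mset (\<lambda>s. s \<noteq> z) m. v s)) (count m z))"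
    have q: "poly q t = (\<Sum>m\<in>M. c m * (\<Prod>s\<in>#m. (v(z := t)) s))" for t
      by (simp add: q_def poly_sum poly_monom mult.assoc prod_mset_fun_upd del: fun_upd_apply)
    have "poly q t = 0" if t: "t \<notin> B" for t
    proof -
      obtain A where A: "A \<in> SL2_tuples k" "\<forall>s\<in>S. s A = (v(z := t)) s" using B(2)[OF t] by blast
      have "(\<Prod>s\<in>#m. (v(z := t)) s) = (\<Prod>s\<in>#m. s A)" if "m \<in> M" for m
        using M(2)[OF that] A(2)
        by (intro arg_cong[of _ _ prod_mset] image_mset_cong) (metis subsetD)
      then show ?thesis using eval_zero[OF A(1)] by (simp add: q)
    qed
    then have "q = 0" by (rule poly_eq_0_cofinite[OF inf B(1)])
    \<comment> \<open>\<open>v(z := v z)\<close> is \<open>v\<close> itself, and \<open>q\<close>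
      vanishes at \<open>v z\<close> even if that value lies in \<open>B\<close>.\<close>
    then show ?thesis using q[of "v z"] by simp
  qed
  show "p m = \<zero>\<^bsub>?R\<^esub>"
  proof (rule ccontr)
    assume "p m \<noteq> \<zero>\<^bsub>?R\<^esub>"
    then have "m \<in> M" by (simp add: M_def)
    with M(2) have "c m = 0" by (intro mpoly_zero_coeffs[OF inf S(1) M(1) _ all]) auto
    then show False using \<open>p m \<noteq> \<zero>\<^bsub>?R\<^esub>\<close> by (simp add: c coord_ring_simps)
  qed
qed

section \<open>Algebraicity\<close>

lemma frac_class_eq_iff:
  assumes "domain R" "a \<in> carrier R" "c \<in> carrier R"
    "b \<in> carrier R - {\<zero>\<^bsub>R\<^esub>}" "d \<in> carrier R - {\<zero>\<^bsub>R\<^esub>}"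
  shows "frac_class R a b = frac_class R c d \<longleftrightarrow> a \<otimes>\<^bsub>R\<^esub> d = c \<otimes>\<^bsub>R\<^esub> b"
  using eq_equiv_class_iff[OF equiv_frac_rel[OF assms(1)], of "(a, b)" "(c, d)"] assms(2-)
  by (auto simp: frac_class_def frac_rel_def)

text \<open>In the application \<open>H\<close> consists of the constants and the proposed basis, so
  that \<open>E\<close> below is the field over which algebraicity is asked.\<close>

locale domain_with_generators = domain R for R :: "('b, 'c) ring_scheme" (structure) +
  fixes H
  assumes H: "H \<subseteq> carrier R"
begin

abbreviation F where "F \<equiv> fraction_field R"

definition emb where "emb a = frac_class R a \<one>"

lemma mem_frac_classD:
  assumes "a \<in> carrier R" "x \<in> frac_class R a \<one>"
  shows "fst x \<in> carrier R" "snd x \<in> carrier R - {\<zero>}" "fst x = a \<otimes> snd x"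
  using assms by (cases x; auto simp: frac_class_def frac_rel_def)+

lemma self_in_frac_class: "a \<in> carrier R \<Longrightarrow> (a, \<one>) \<in> frac_class R a \<one>"
  by (auto simp: frac_class_def frac_rel_def)

lemma emb_hom: "emb \<in> ring_hom R F"
proof (rule ring_hom_memI)
  fix a assume a: "a \<in> carrier R"
  then have "(a, \<one>) \<in> carrier R \<times> (carrier R - {\<zero>})" by simp
  then show "emb a \<in> carrier F"
    unfolding emb_def fraction_field_def frac_class_def partial_object.simps by (rule quotientI)
  fix c assume c: "c \<in> carrier R"
  show "emb (a \<otimes> c) = emb a \<otimes>\<^bsub>F\<^esub> emb c"
    unfolding emb_def fraction_field_def monoid.simps
  proof (rule UN_UN_const[symmetric, OF self_in_frac_class[OF a] self_in_frac_class[OF c]])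
    fix x y assume "x \<in> frac_class R a \<one>" "y \<in> frac_class R c \<one>"
    note x = mem_frac_classD[OF a this(1)] and y = mem_frac_classD[OF c this(2)]
    show "frac_class R (fst x \<otimes> fst y) (snd x \<otimes> snd y) = frac_class R (a \<otimes> c) \<one>"
      using x y a c integral by (subst frac_class_eq_iff[OF domain_axioms]) (auto simp: m_ac)
  qed
  show "emb (a \<oplus> c) = emb a \<oplus>\<^bsub>F\<^esub> emb c"
    unfolding emb_def fraction_field_def monoid.simps ring.simps
  proof (rule UN_UN_const[symmetric, OF self_in_frac_class[OF a] self_in_frac_class[OF c]])
    fix x y assume "x \<in> frac_class R a \<one>" "y \<in> frac_class R c \<one>"
    note x = mem_frac_classD[OF a this(1)] and y = mem_frac_classD[OF c this(2)]
    show "frac_class R (fst x \<otimes> snd y \<oplus> fst y \<otimes> snd x) (snd x \<otimes> snd y) = frac_class R (a \<oplus> c) \<one>"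
      using x y a c integral
      by (subst frac_class_eq_iff[OF domain_axioms]) (auto simp: m_ac l_distr r_distr)
  qed
qed (simp add: emb_def fraction_field_def)

sublocale F: field F
  by (rule field_fraction_field[OF domain_axioms])

sublocale emb: ring_hom_cring R F emb
  by unfold_locales (rule emb_hom)

lemma emb_eq_zero: "a \<in> carrier R \<Longrightarrow> emb a = \<zero>\<^bsub>F\<^esub> \<longleftrightarrow> a = \<zero>"
  using frac_class_eq_iff[OF domain_axioms, of a \<zero> \<one> \<one>] by (simp add: emb_def fraction_field_def)

definition E where "E = generate_field F (emb ` H)"

text \<open>Pulling \<open>E\<close> and its relative algebraic closure back to \<open>R\<close>
  gives two sets of functions that can serve as a \<open>function_algebra\<close>.\<close>

definition rat where "rat = {a \<in> carrier R. emb a \<in> E}"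

definition alg where "alg = {a \<in> carrier R. (F.algebraic over E) (emb a)}"

lemma subfield_E: "subfield E F"
  unfolding E_def by (rule F.generate_field_is_subfield) (use H in auto)

lemma subfield_alg: "subfield {x \<in> carrier F. (F.algebraic over E) x} F"
  by (rule F.subfield_of_algebraics[OF subfield_E])

lemma rat_incl: "a \<in> H \<Longrightarrow> a \<in> rat"
  using H by (auto simp: rat_def E_def intro: generate_field.incl)

lemma rat_sub_alg: "rat \<subseteq> alg"
  using F.algebraic_self[OF subfieldE(1)[OF subfield_E]] by (auto simp: rat_def alg_def)

lemma rat_closed: "a \<in> rat \<Longrightarrow> b \<in> rat \<Longrightarrow> a \<oplus> b \<in> rat" "a \<in> rat \<Longrightarrow> b \<in> rat \<Longrightarrow> a \<otimes> b \<in> rat"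
  using subringE(6,7)[OF subfieldE(1)[OF subfield_E]] by (auto simp: rat_def)

lemma alg_closed_add: "a \<in> alg \<Longrightarrow> b \<in> alg \<Longrightarrow> a \<oplus> b \<in> alg"
  and alg_closed_mult: "a \<in> alg \<Longrightarrow> b \<in> alg \<Longrightarrow> a \<otimes> b \<in> alg"
  using subringE(6,7)[OF subfieldE(1)[OF subfield_alg], of "emb a" "emb b"] by (auto simp: alg_def)

text \<open>Division by \<open>d\<close> happens in the fraction field, whose algebraic elements
  form a subfield. This is how the discriminant gets cleared.\<close>

lemma alg_cancel:
  assumes "d \<in> alg" "d \<noteq> \<zero>" "a \<in> carrier R" "d \<otimes> a \<in> alg"
  shows "a \<in> alg"
proof -
  let ?L = "{x \<in> carrier F. (F.algebraic over E) x}"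
  have d: "d \<in> carrier R" using assms by (simp add: alg_def)
  then have u: "emb d \<in> Units F" using assms(2) emb_eq_zero F.field_Units by auto
  have "inv\<^bsub>F\<^esub> (emb d) \<in> ?L"
    using F.subfield_m_inv(1)[OF subfield_alg, of "emb d"] assms d emb_eq_zero by (auto simp: alg_def)
  then have "inv\<^bsub>F\<^esub> (emb d) \<otimes>\<^bsub>F\<^esub> emb (d \<otimes> a) \<in> ?L"
    using subringE(6)[OF subfieldE(1)[OF subfield_alg]] assms(4) by (auto simp: alg_def)
  also have "inv\<^bsub>F\<^esub> (emb d) \<otimes>\<^bsub>F\<^esub> emb (d \<otimes> a) = emb a"
    using u d assms(3) by (simp add: F.m_assoc[symmetric])
  finally show ?thesis using assms(3) by (simp add: alg_def)
qed

lemma alg_quadratic: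
  assumes "p \<in> rat" "q \<in> rat" "a \<in> carrier R" "a \<otimes> a \<oplus> p \<otimes> a \<oplus> q = \<zero>"
  shows "a \<in> alg"
proof -
  \<comment> \<open>Coefficient lists begin with the leading coefficient: this is X^2 + pX +
    q.\<close>
  let ?f = "[\<one>\<^bsub>F\<^esub>, emb p, emb q]"
  have C: "p \<in> carrier R" "q \<in> carrier R" using assms by (auto simp: rat_def)
  have "?f \<in> carrier (E [X]\<^bsub>F\<^esub>)"
    using subringE(3)[OF subfieldE(1)[OF subfield_E]] assms(1,2)
    by (auto simp: rat_def univ_poly_def polynomial_def)
  moreover have "F.eval ?f (emb a) = emb (a \<otimes> a \<oplus> p \<otimes> a \<oplus> q)"
    using C assms(3) by (simp add: numeral_2_eq_2 F.a_assoc)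
  ultimately have "(F.algebraic over E) (emb a)"
    using assms(4) by (intro F.algebraicI[of ?f]) auto
  then show ?thesis using assms(3) by (simp add: alg_def)
qed

end

text \<open>For a generic pair \<open>M, N\<close> in \<open>SL\<^sub>2\<close> the matrices \<open>1, M, N, MN\<close> are a basis of the matrix
  algebra; their Gram matrix with respect to the trace form has determinant \<open>- disc\<^sup>2\<close>, and the
  coefficients below are \<open>disc\<close> times the entries of its inverse.\<close>

definition disc :: "'a::comm_ring_1 \<Rightarrow> 'a \<Rightarrow> 'a \<Rightarrow> 'a"
  where "disc x y z = x * x + y * y + z * z - x * y * z - 4"

text \<open>Keeping the determinants \<open>dM\<close> and \<open>dN\<close> as expressions makes
  these plain polynomial identities over any commutative ring; at determinant 1 the factor
  \<open>D - 4*dM*dN\<close> becomes \<open>disc x y z\<close>.\<close>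

lemma basis_coordinates:
  fixes m1 m2 m3 m4 n1 n2 n3 n4 q1 q2 q3 q4 :: "'a::comm_ring_1"
  defines "dM \<equiv> m1*m4 - m2*m3" and "dN \<equiv> n1*n4 - n2*n3"
    and "x \<equiv> m1+m4" and "y \<equiv> n1+n4" and "z \<equiv> m1*n1+m2*n3+m3*n2+m4*n4"
    and "u0 \<equiv> q1+q4" and "u1 \<equiv> m1*q1+m2*q3+m3*q2+m4*q4" and "u2 \<equiv> n1*q1+n2*q3+n3*q2+n4*q4"
    and "u3 \<equiv> (m1*n1+m2*n3)*q1+(m1*n2+m2*n4)*q3+(m3*n1+m4*n3)*q2+(m3*n2+m4*n4)*q4"
  defines "D \<equiv> x*x*dN + y*y*dM + z*z - x*y*z"
    and "e0 \<equiv> (x*x*dN + y*y*dM + z*z - x*y*z - 2*dM*dN)*u0 - x*dN*u1 - y*dM*u2 - (z - x*y)*u3"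
    and "e1 \<equiv> 2*dN*u1 - x*dN*u0 + z*u2 - y*u3"
    and "e2 \<equiv> 2*dM*u2 - y*dM*u0 + z*u1 - x*u3"
    and "e3 \<equiv> 2*u3 - (z - x*y)*u0 - y*u1 - x*u2"
  shows "(D - 4*dM*dN)*q1 = e0 + e1*m1 + e2*n1 + e3*(m1*n1+m2*n3)" (is ?t1)
    and "(D - 4*dM*dN)*q2 = e1*m2 + e2*n2 + e3*(m1*n2+m2*n4)" (is ?t2)
    and "(D - 4*dM*dN)*q3 = e1*m3 + e2*n3 + e3*(m3*n1+m4*n3)" (is ?t3)
    and "(D - 4*dM*dN)*q4 = e0 + e1*m4 + e2*n4 + e3*(m3*n2+m4*n4)" (is ?t4)
proof -
  show ?t1 unfolding assms by (simp add: algebra_simps)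
  show ?t2 unfolding assms by (simp add: algebra_simps)
  show ?t3 unfolding assms by (simp add: algebra_simps)
  show ?t4 unfolding assms by (simp add: algebra_simps)
qed

text \<open>Expand \<open>disc x y z\<close> times \<open>P\<close> in the basis 1,
  \<open>M\<close>, \<open>N\<close>, \<open>M ** N\<close>, multiply by \<open>Q\<close> and take
  traces. The result is bilinear in the traces of \<open>P\<close> and of \<open>Q\<close> against
  the basis.\<close>

lemma disc_mult_trace:
  fixes M N P Q :: "'a::field ^ 2 ^ 2"
  assumes "det M = 1" "det N = 1"
  defines "x \<equiv> trace M" and "y \<equiv> trace N" and "z \<equiv> trace (M ** N)"
    and "u0 \<equiv> trace P" and "u1 \<equiv> trace (M ** P)" and "u2 \<equiv> trace (N ** P)" and "u3 \<equiv> trace (M ** N ** P)"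
  shows "disc x y z * trace (P ** Q) =
    ((disc x y z + 2) * u0 - x * u1 - y * u2 - (z - x*y) * u3) * trace Q
    + (2 * u1 - x * u0 + z * u2 - y * u3) * trace (M ** Q)
    + (2 * u2 - y * u0 + z * u1 - x * u3) * trace (N ** Q)
    + (2 * u3 - (z - x*y) * u0 - y * u1 - x * u2) * trace (M ** N ** Q)"
proof -
  have dets: "M$1$1 * M$2$2 - M$1$2 * M$2$1 = 1" "N$1$1 * N$2$2 - N$1$2 * N$2$1 = 1"
    using assms by (simp_all add: det_2)
  define e0 where "e0 = (disc x y z + 2) * u0 - x * u1 - y * u2 - (z - x*y) * u3"
  define e1 where "e1 = 2 * u1 - x * u0 + z * u2 - y * u3"
  define e2 where "e2 = 2 * u2 - y * u0 + z * u1 - x * u3"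
  define e3 where "e3 = 2 * u3 - (z - x*y) * u0 - y * u1 - x * u2"
  note defs = x_def y_def z_def u0_def u1_def u2_def u3_def e0_def e1_def e2_def e3_def
    disc_def trace_2 matrix_mult_2
  note coords = basis_coordinates[where ?m1.0 = "M$1$1" and ?m2.0 = "M$1$2" and ?m3.0 = "M$2$1"
    and ?m4.0 = "M$2$2" and ?n1.0 = "N$1$1" and ?n2.0 = "N$1$2" and ?n3.0 = "N$2$1" and ?n4.0 = "N$2$2"
    and ?q1.0 = "P$1$1" and ?q2.0 = "P$1$2" and ?q3.0 = "P$2$1" and ?q4.0 = "P$2$2", unfolded dets]
  have P: "disc x y z * P$1$1 = e0 + e1 * M$1$1 + e2 * N$1$1 + e3 * (M ** N)$1$1"
    "disc x y z * P$1$2 = e1 * M$1$2 + e2 * N$1$2 + e3 * (M ** N)$1$2"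
    "disc x y z * P$2$1 = e1 * M$2$1 + e2 * N$2$1 + e3 * (M ** N)$2$1"
    "disc x y z * P$2$2 = e0 + e1 * M$2$2 + e2 * N$2$2 + e3 * (M ** N)$2$2"
    using coords by (simp_all add: defs ac_simps)
  have "disc x y z * trace (P ** Q) = (disc x y z * P$1$1) * Q$1$1 + (disc x y z * P$1$2) * Q$2$1
      + (disc x y z * P$2$1) * Q$1$2 + (disc x y z * P$2$2) * Q$2$2"
    by (simp add: trace_2 matrix_mult_2 distrib_left mult.assoc)
  also have "\<dots> = e0 * trace Q + e1 * trace (M ** Q) + e2 * trace (N ** Q) + e3 * trace (M ** N ** Q)"
    unfolding P by (simp add: trace_2 matrix_mult_2[of _ Q] algebra_simps)
  finally show ?thesis by (simp only: e0_def e1_def e2_def e3_def)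
qed

text \<open>The two traces \<open>tr(MNP)\<close> and \<open>tr(MPN)\<close> are the roots of a monic quadratic polynomial over the
  ring of the other traces (Fricke).\<close>

lemma fricke_product:
  fixes a1 a2 a3 a4 b1 b2 b3 b4 c1 c2 c3 c4 :: "'a::comm_ring_1"
  shows "((a1*b1+a2*b3)*c1+(a1*b2+a2*b4)*c3+(a3*b1+a4*b3)*c2+(a3*b2+a4*b4)*c4)
      * ((a1*c1+a2*c3)*b1+(a1*c2+a2*c4)*b3+(a3*c1+a4*c3)*b2+(a3*c2+a4*c4)*b4)
   = (a1+a4)*(a1+a4)*(b1*b4-b2*b3)*(c1*c4-c2*c3) + (b1+b4)*(b1+b4)*(a1*a4-a2*a3)*(c1*c4-c2*c3)
   + (c1+c4)*(c1+c4)*(a1*a4-a2*a3)*(b1*b4-b2*b3)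
   + (a1*b1+a2*b3+a3*b2+a4*b4)*(a1*b1+a2*b3+a3*b2+a4*b4)*(c1*c4-c2*c3)
   + (a1*c1+a2*c3+a3*c2+a4*c4)*(a1*c1+a2*c3+a3*c2+a4*c4)*(b1*b4-b2*b3)
   + (b1*c1+b2*c3+b3*c2+b4*c4)*(b1*c1+b2*c3+b3*c2+b4*c4)*(a1*a4-a2*a3)
   - (a1+a4)*(b1+b4)*(a1*b1+a2*b3+a3*b2+a4*b4)*(c1*c4-c2*c3)
   - (b1+b4)*(c1+c4)*(b1*c1+b2*c3+b3*c2+b4*c4)*(a1*a4-a2*a3)
   - (a1+a4)*(c1+c4)*(a1*c1+a2*c3+a3*c2+a4*c4)*(b1*b4-b2*b3)
   + (a1*b1+a2*b3+a3*b2+a4*b4)*(a1*c1+a2*c3+a3*c2+a4*c4)*(b1*c1+b2*c3+b3*c2+b4*c4)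
   - 4*(a1*a4-a2*a3)*(b1*b4-b2*b3)*(c1*c4-c2*c3)"
  by (simp add: algebra_simps)

lemma fricke_quadratic:
  fixes M N P :: "'a::field ^ 2 ^ 2"
  assumes "det M = 1" "det N = 1" "det P = 1"
  defines "x \<equiv> trace M" and "y \<equiv> trace N" and "w \<equiv> trace P"
    and "p \<equiv> trace (M ** N)" and "q \<equiv> trace (M ** P)" and "r \<equiv> trace (N ** P)"
    and "d \<equiv> trace (M ** N ** P)"
  shows "d * d + - (x*r + y*q + (p - x*y)*w) * d
    + (x*x + y*y + w*w + p*p + q*q + r*r - x*y*p - y*w*r - x*w*q + p*q*r - 4) = 0"
proof -
  have dets: "M$1$1 * M$2$2 - M$1$2 * M$2$1 = 1" "N$1$1 * N$2$2 - N$1$2 * N$2$1 = 1"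
    "P$1$1 * P$2$2 - P$1$2 * P$2$1 = 1"
    using assms by (simp_all add: det_2)
  \<comment> \<open>By Vieta it suffices to know the product of the two roots, found here, and their
    sum, which \<open>trace_swap\<close> supplies next.\<close>
  have "d * trace (M ** P ** N) =
    x*x + y*y + w*w + p*p + q*q + r*r - x*y*p - y*w*r - x*w*q + p*q*r - 4"
    using fricke_product[of "M$1$1" "N$1$1" "M$1$2" "N$2$1" "P$1$1" "N$1$2" "N$2$2" "P$2$1" "M$2$1" "M$2$2"
      "P$1$2" "P$2$2", unfolded dets]
    by (simp add: x_def y_def w_def p_def q_def r_def d_def trace_2 matrix_mult_2 ac_simps)
  moreover have "trace (M ** P ** N) = x*r + y*q + (p - x*y)*w - d"
    unfolding x_def y_def w_def p_def q_def r_def d_def trace_swap[of M N P]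
    by (simp add: trace_2 matrix_mult_2 algebra_simps)
  ultimately show ?thesis by (simp add: algebra_simps)
qed

text \<open>The matrix identity MNM = tr(N) M^2 + (tr(MN) - tr(M) tr(N)) M + N, tested against
  \<open>Z\<close>. The pattern arises when \<open>A 1\<close> is prepended to a matrix tested
  against \<open>A 1 ** A 2\<close>.\<close>

lemma trace_sandwich:
  fixes M N Z :: "'a::field ^ 2 ^ 2"
  assumes "det M = 1"
  shows "trace (M ** N ** M ** Z) = trace N * trace (M ** M ** Z)
    + (trace (M ** N) - trace M * trace N) * trace (M ** Z) + trace (N ** Z)"
proof -
  have "trace (M ** N ** (M ** Z)) = trace M * trace (N ** (M ** Z)) + trace N * trace (M ** (M ** Z))
    + (trace (M ** N) - trace M * trace N) * trace (M ** Z) - trace (N ** M ** (M ** Z))"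
    by (rule trace_swap)
  also have "trace (N ** M ** (M ** Z)) = trace (M ** M ** (Z ** N))"
    using trace_mult_commute[of N "M ** (M ** Z)"] by (simp add: matrix_mul_assoc)
  also have "\<dots> = trace M * trace (N ** (M ** Z)) - trace (N ** Z)"
    unfolding trace_square[OF assms] using trace_mult_commute[of N Z] trace_mult_commute[of N "M ** Z"]
    by (simp add: matrix_mul_assoc)
  finally show ?thesis by (simp add: matrix_mul_assoc)
qed

lemma trace_square_right:
  fixes M N Z :: "'a::field ^ 2 ^ 2"
  assumes "det N = 1"
  shows "trace (M ** N ** N ** Z) = trace N * trace (M ** N ** Z) - trace (M ** Z)"
  using trace_square[OF assms, of "Z ** M"]
  by (simp add: matrix_mul_assoc[symmetric] trace_mult_commute[of M])

section \<open>Matrices with controlled traces against a generic basis\<close>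

context function_algebra
begin

declare One_nat_def [simp del]

text \<open>These traces against 1, \<open>A 1\<close>, \<open>A 2\<close>,
  \<open>A 1 ** A 2\<close> are exactly the data that \<open>disc_mult_trace\<close> consumes for
  each factor.\<close>

definition good :: "((nat \<Rightarrow> 'a ^ 2 ^ 2) \<Rightarrow> 'a ^ 2 ^ 2) \<Rightarrow> bool"
  where "good M \<longleftrightarrow> mem (\<lambda>A. trace (M A)) \<and> mem (\<lambda>A. trace (A 1 ** M A)) \<and>
    mem (\<lambda>A. trace (A 2 ** M A)) \<and> mem (\<lambda>A. trace (A 1 ** A 2 ** M A))"

lemma good_cong: "(\<And>A. A \<in> SL2_tuples k \<Longrightarrow> M A = N A) \<Longrightarrow> good M \<longleftrightarrow> good N"
  unfolding good_def by (intro arg_cong2[of _ _ _ _ "(\<and>)"] mem_cong) auto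

lemma good_adjugate:
  assumes "good M" "good (\<lambda>A. mat 1)"
  shows "good (\<lambda>A. mat (trace (M A)) - M A)"
proof -
  have *: "trace (N ** (mat (trace P) - P)) = trace P * trace (N ** mat 1) - trace (N ** P)"
    "trace (mat (trace P) - P) = trace P * trace (mat 1 :: 'a ^ 2 ^ 2) - trace P" for N P :: "'a ^ 2 ^ 2"
    using trace_adjugate[of N P "mat 1"] trace_adjugate[of "mat 1" P "mat 1"] by simp_all
  show ?thesis
    using assms unfolding good_def * by (auto intro!: mem_intros)
qed

context
  assumes k: "k \<ge> 2"
    and pair: "mem (\<lambda>A. trace (A 1))" "mem (\<lambda>A. trace (A 2))" "mem (\<lambda>A. trace (A 1 ** A 2))"
begin

lemma good_one: "good (\<lambda>A. mat 1)"
  using pair mem_const[of "trace (mat 1 :: 'a ^ 2 ^ 2)"] by (simp add: good_def)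

lemma det_12: "A \<in> SL2_tuples k \<Longrightarrow> det (A 1) = 1" "A \<in> SL2_tuples k \<Longrightarrow> det (A 2) = 1"
  using k SL2_tuplesD[of A k] by auto

text \<open>A basis matrix times \<open>A 1\<close> or \<open>A 2\<close> on the right is a
  combination of basis matrices with coefficients polynomial in the traces of the pair, so no
  division by the discriminant occurs.\<close>

lemma good_left:
  assumes "good M"
  shows "good (\<lambda>A. A 1 ** M A)" "good (\<lambda>A. A 2 ** M A)"
proof -
  note M = assms[unfolded good_def]
  have 11: "mem (\<lambda>A. trace (A 1 ** (A 1 ** M A)))"
    using mem_diff[OF mem_mult[OF pair(1)], of "\<lambda>A. trace (A 1 ** M A)" "\<lambda>A. trace (M A)"] M
    by (subst mem_cong) (auto simp: matrix_mul_assoc trace_square det_12)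
  have 22: "mem (\<lambda>A. trace (A 2 ** (A 2 ** M A)))"
    using mem_diff[OF mem_mult[OF pair(2)], of "\<lambda>A. trace (A 2 ** M A)" "\<lambda>A. trace (M A)"] M
    by (subst mem_cong) (auto simp: matrix_mul_assoc trace_square det_12)
  have 21: "mem (\<lambda>A. trace (A 2 ** (A 1 ** M A)))"
  proof -
    have "mem (\<lambda>A. trace (A 1) * trace (A 2 ** M A) + trace (A 2) * trace (A 1 ** M A)
      + (trace (A 1 ** A 2) - trace (A 1) * trace (A 2)) * trace (M A) - trace (A 1 ** A 2 ** M A))"
      using M by (intro mem_intros pair) auto
    then show ?thesis by (simp add: matrix_mul_assoc trace_swap[of "_ 1" "_ 2"])
  qed
  have 121: "mem (\<lambda>A. trace (A 1 ** A 2 ** (A 1 ** M A)))"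
  proof -
    have "mem (\<lambda>A. trace (A 2) * trace (A 1 ** (A 1 ** M A))
      + (trace (A 1 ** A 2) - trace (A 1) * trace (A 2)) * trace (A 1 ** M A) + trace (A 2 ** M A))"
      using M by (intro mem_intros pair 11) auto
    then show ?thesis
      by (subst mem_cong) (auto simp: matrix_mul_assoc trace_sandwich det_12)
  qed
  have 122: "mem (\<lambda>A. trace (A 1 ** A 2 ** (A 2 ** M A)))"
  proof -
    have "mem (\<lambda>A. trace (A 2) * trace (A 1 ** A 2 ** M A) - trace (A 1 ** M A))"
      using M by (intro mem_intros pair) auto
    then show ?thesis
      by (subst mem_cong) (auto simp: matrix_mul_assoc trace_square_right det_12)
  qed
  show "good (\<lambda>A. A 1 ** M A)" "good (\<lambda>A. A 2 ** M A)"
    using M 11 21 121 22 122 by (simp_all add: good_def matrix_mul_assoc)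
qed

lemma good_mult_disc:
  assumes "good M" "good N"
  shows "mem (\<lambda>A. disc (trace (A 1)) (trace (A 2)) (trace (A 1 ** A 2)) * trace (M A ** N A))"
proof -
  have "mem (\<lambda>A. disc (trace (A 1)) (trace (A 2)) (trace (A 1 ** A 2)))"
    unfolding disc_def by (intro mem_intros pair)
  with assms show ?thesis
    unfolding good_def
    by (subst mem_cong[OF disc_mult_trace]) (auto simp: det_12 intro!: mem_intros pair)
qed

end

end

section \<open>Realising prescribed traces\<close>

lemma quadratic_root:
  fixes a b c :: "'a::alg_closed_field"
  assumes "a \<noteq> 0"
  obtains t where "a * t * t + b * t + c = 0"
proof -
  have "Polynomial.degree [:c, b, a:] > 0" using assms by simp
  then obtain t where "poly [:c, b, a:] t = 0" using alg_closed_imp_poly_has_root by blast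
  then have "a * t * t + b * t + c = 0" by (simp add: algebra_simps)
  then show thesis by (rule that)
qed

text \<open>\<open>M\<close> is a companion matrix and \<open>N\<close> has a vanishing corner. The
  trace conditions on \<open>P\<close> are linear and leave one entry \<open>e\<close> free;
  determinant 1 is then a quadratic equation for \<open>e\<close>, whose degeneration the two
  inequalities exclude.\<close>

lemma exists_SL2_traces:
  fixes x y z :: "'a::alg_closed_field"
  shows "\<exists>M N :: 'a ^ 2 ^ 2. det M = 1 \<and> det N = 1 \<and> trace M = x \<and> trace N = y \<and> trace (M ** N) = z \<and>
    (z * z \<noteq> 4 \<and> disc x y z \<noteq> 0 \<longrightarrow>
      (\<forall>a b c. \<exists>P. det P = 1 \<and> trace P = a \<and> trace (M ** P) = b \<and> trace (N ** P) = c))"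
proof -
  obtain r where r: "r * r + z * r + 1 = 0"
    using quadratic_root[of 1 z 1] by auto
  \<comment> \<open>For the matrix \<open>N\<close> below, \<open>trace (M ** N)\<close> is
    \<open>q - r\<close> and \<open>det N\<close> is \<open>- q * r\<close>; prescribing both makes
    \<open>r\<close> a root of the quadratic above.\<close>
  define q where "q = z + r"
  have qr: "q * r = - 1" using r by (simp add: q_def algebra_simps eq_neg_iff_add_eq_0)
  define M N :: "'a ^ 2 ^ 2" where "M = vector [vector [x, -1], vector [1, 0]]"
    and "N = vector [vector [0, q], vector [r, y]]"
  have MN: "M$1$1 = x" "M$1$2 = -1" "M$2$1 = 1" "M$2$2 = 0" "N$1$1 = 0" "N$1$2 = q" "N$2$1 = r" "N$2$2 = y"
    by (simp_all add: M_def N_def vector_2)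
  have "\<exists>P :: 'a ^ 2 ^ 2. det P = 1 \<and> trace P = a \<and> trace (M ** P) = b \<and> trace (N ** P) = c"
    if z: "z * z \<noteq> 4" and disc: "disc x y z \<noteq> 0" for a b c
  proof -
    \<comment> \<open>With \<open>e\<close> and \<open>g\<close> the first column of
      \<open>P\<close>, the condition on \<open>trace (N ** P)\<close> becomes
      \<open>w * g = m + l * e\<close>.\<close>
    define w l m where "w = q + r" and "l = r * x + y" and "m = c - r * b - y * a"
    have "w * w = z * z - 4 + 4 * (r * r + z * r + 1)"
      by (simp add: w_def q_def algebra_simps)
    with z r have w: "w \<noteq> 0" by auto
    \<comment> \<open>After multiplication by \<open>w * w\<close>, the determinant equation has
      minus this expression as leading coefficient; since \<open>r\<close> is a root, it equals the
      discriminant.\<close>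
    have "w * w - x * l * w + l * l = disc x y z + (4 - x * x) * (r * r + z * r + 1)"
      by (simp add: w_def q_def l_def disc_def algebra_simps)
    with disc r have "- (w * w - x * l * w + l * l) \<noteq> 0" by simp
    then obtain e where e: "- (w * w - x * l * w + l * l) * e * e
        + (w * w * a + x * w * m - l * (b * w + m) - l * m) * e + (- m * (b * w + m) - w * w) = 0"
      by (rule quadratic_root)
    define g where "g = (m + l * e) / w"
    have g: "w * g = m + l * e" using w by (simp add: g_def)
    define P :: "'a ^ 2 ^ 2" where "P = vector [vector [e, b - x * e + g], vector [g, a - e]]"
    have P: "P$1$1 = e" "P$1$2 = b - x * e + g" "P$2$1 = g" "P$2$2 = a - e"
      by (simp_all add: P_def vector_2)
    have "w * w * (e * (a - e) - (b - x * e + g) * g - 1)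
      = w * w * (e * (a - e) - 1) - (w * b - x * w * e + w * g) * (w * g)"
      by (simp add: algebra_simps)
    also have "\<dots> = 0" unfolding g using e by (simp add: algebra_simps)
    finally have "det P = 1" using w by (simp add: det_2 P)
    moreover have "trace (N ** P) = w * g - m - l * e + c"
      by (simp add: trace_2 matrix_mult_2 MN P w_def l_def m_def algebra_simps)
    ultimately show ?thesis
      using g by (intro exI[of _ P]) (simp add: trace_2 matrix_mult_2 MN P)
  qed
  moreover have "det M = 1" "det N = 1" "trace M = x" "trace N = y" "trace (M ** N) = z"
    using qr by (simp_all add: det_2 trace_2 matrix_mult_2 MN q_def algebra_simps)
  ultimately show ?thesis by blast
qed

section \<open>Generation, independence and algebraicity of the trace functions\<close>

lemma rep_positive: "rep A (map (\<lambda>i. (i, True)) w) = word_prod A w"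
  by (induction w) (simp_all add: rep_Cons letter_value_def, simp add: rep_def)

lemma tr_on_tuples_word:
  assumes "set w \<subseteq> {1..k}"
  shows "tr_on_tuples k (\<lambda>A. word_prod A w) \<in> carrier (coord_ring k)"
  using trace_rep_in_coord_ring[of "map (\<lambda>i. (i, True)) w" k] assms
  by (auto simp: tr_on_tuples_def rep_positive)

lemma tr_on_tuples_in_coord_ring:
  "i \<in> {1..k} \<Longrightarrow> tr_on_tuples k (\<lambda>A. A i) \<in> carrier (coord_ring k)"
  "i \<in> {1..k} \<Longrightarrow> j \<in> {1..k} \<Longrightarrow> tr_on_tuples k (\<lambda>A. A i ** A j) \<in> carrier (coord_ring k)"
  "i \<in> {1..k} \<Longrightarrow> j \<in> {1..k} \<Longrightarrow> l \<in> {1..k} \<Longrightarrow>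
    tr_on_tuples k (\<lambda>A. A i ** A j ** A l) \<in> carrier (coord_ring k)"
  using tr_on_tuples_word[of "[i]" k] tr_on_tuples_word[of "[i, j]" k] tr_on_tuples_word[of "[i, j, l]" k]
  by (simp_all add: matrix_mul_assoc)

lemma constants_in_coord_ring: "constants k \<subseteq> carrier (coord_ring k)"
  using function_algebra.const[OF function_algebra_coord_ring] by (auto simp: constants_def)

lemma (in function_algebra) mem_tr_on_tuples: "mem (\<lambda>A. trace (M A)) \<longleftrightarrow> tr_on_tuples k M \<in> C"
  by (simp add: mem_def tr_on_tuples_def)

lemma trace_generators:
  assumes "CHAR('a::field) \<noteq> 2 \<or> k \<le> 3"
  shows "generated_algebra (coord_ring k :: ((nat \<Rightarrow> 'a ^ 2 ^ 2) \<Rightarrow> 'a) ring) (constants k)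
         ({tr_on_tuples k (\<lambda>A. A i) | i. i \<in> {1..k}} \<union>
          {tr_on_tuples k (\<lambda>A. A i ** A j) | i j. i \<in> {1..k} \<and> j \<in> {1..k} \<and> i < j} \<union>
          {tr_on_tuples k (\<lambda>A. A i ** A j ** A l) | i j l.
             i \<in> {1..k} \<and> j \<in> {1..k} \<and> l \<in> {1..k} \<and> i < j \<and> j < l})
       = carrier (coord_ring k)" (is "generated_algebra ?R ?K ?G = _")
proof
  interpret cring ?R by (rule cring_coord_ring)
  have "?K \<union> ?G \<subseteq> carrier ?R"
    using constants_in_coord_ring tr_on_tuples_in_coord_ring by blast
  then show "generated_algebra ?R ?K ?G \<subseteq> carrier ?R"
    unfolding generated_algebra_def by (rule generate_ring_incl)
  interpret T: function_algebra k "generated_algebra ?R ?K ?G"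
    unfolding generated_algebra_def by (rule function_algebra_generate) (rule coord_ring_simps)+
  have incl: "s \<in> generated_algebra ?R ?K ?G" if "s \<in> ?G" for s
    unfolding generated_algebra_def using that by (intro generate_ring.incl) blast
  have pos: "T.mem (\<lambda>A. trace (word_prod A u))" if "set u \<subseteq> {1..k}" for u
    by (rule T.mem_trace_word_prod[OF _ _ _ assms that])
      (unfold T.mem_tr_on_tuples, (rule incl, blast)+)
  show "carrier ?R \<subseteq> generated_algebra ?R ?K ?G"
  proof (rule coord_ring_least[OF T.function_algebra_axioms])
    fix w assume "w \<in> carrier (free_group k)"
    then have "set w \<subseteq> {1..k} \<times> UNIV" by (auto simp: free_group_def)
    then have "T.mem (\<lambda>A. trace (rep A w))"
      using T.mem_trace_rep[OF pos, of w "[]"] by simp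
    then show "trace_fun k w \<in> generated_algebra ?R ?K ?G"
      unfolding T.mem_def trace_fun_def character_def .
  qed
qed

context
begin

declare One_nat_def [simp del]

definition basis_traces :: "nat \<Rightarrow> ((nat \<Rightarrow> 'a::field ^ 2 ^ 2) \<Rightarrow> 'a) set"
  where "basis_traces k =
    {tr_on_tuples k (\<lambda>A. A 1), tr_on_tuples k (\<lambda>A. A 2), tr_on_tuples k (\<lambda>A. A 1 ** A 2)} \<union>
    (\<Union>j\<in>{3..k}. {tr_on_tuples k (\<lambda>A. A j), tr_on_tuples k (\<lambda>A. A 1 ** A j),
       tr_on_tuples k (\<lambda>A. A 2 ** A j)})"

lemma finite_basis_traces: "finite (basis_traces k)"
  by (simp add: basis_traces_def)

lemma basis_traces_in_coord_ring:
  assumes "k \<ge> 2" shows "basis_traces k \<subseteq> carrier (coord_ring k)"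
  using assms by (auto simp: basis_traces_def intro!: tr_on_tuples_in_coord_ring)

text \<open>For \<open>j \<ge> 3\<close> the prescribed values involve \<open>A j\<close> only
  together with the fixed pair, so these matrices can be chosen independently of each other.\<close>

lemma basis_traces_generic:
  fixes v :: "((nat \<Rightarrow> 'a::alg_closed_field ^ 2 ^ 2) \<Rightarrow> 'a) \<Rightarrow> 'a"
  assumes k: "k \<ge> 2"
  defines "x \<equiv> v (tr_on_tuples k (\<lambda>A. A 1))" and "y \<equiv> v (tr_on_tuples k (\<lambda>A. A 2))"
    and "z \<equiv> v (tr_on_tuples k (\<lambda>A. A 1 ** A 2))"
  assumes z: "z * z \<noteq> 4" "disc x y z \<noteq> 0"
  shows "\<exists>A\<in>SL2_tuples k. \<forall>s\<in>basis_traces k. s A = v s"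
proof -
  obtain M N :: "'a ^ 2 ^ 2" where MN: "det M = 1" "det N = 1" "trace M = x" "trace N = y" "trace (M ** N) = z"
    and "\<And>a b c. \<exists>P. det P = 1 \<and> trace P = a \<and> trace (M ** P) = b \<and> trace (N ** P) = c"
    using exists_SL2_traces[of x y z] z by blast
  then obtain P where P: "\<And>a b c. det (P a b c) = 1 \<and> trace (P a b c) = a \<and>
      trace (M ** P a b c) = b \<and> trace (N ** P a b c) = c"
    by metis
  define A where "A = (\<lambda>i\<in>{1..k}. if i = 1 then M else if i = 2 then N else
    P (v (tr_on_tuples k (\<lambda>A. A i))) (v (tr_on_tuples k (\<lambda>A. A 1 ** A i)))
      (v (tr_on_tuples k (\<lambda>A. A 2 ** A i))))"
  have A: "A \<in> SL2_tuples k"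
    using MN P by (auto simp: SL2_tuples_def A_def)
  have A12: "A 1 = M" "A 2 = N" using k by (auto simp: A_def)
  have "s A = v s" if s: "s \<in> basis_traces k" for s
  proof -
    consider "s = tr_on_tuples k (\<lambda>A. A 1)" | "s = tr_on_tuples k (\<lambda>A. A 2)" 
      | "s = tr_on_tuples k (\<lambda>A. A 1 ** A 2)"
      | j where "j \<in> {3..k}" "s = tr_on_tuples k (\<lambda>A. A j) \<or> s = tr_on_tuples k (\<lambda>A. A 1 ** A j)
          \<or> s = tr_on_tuples k (\<lambda>A. A 2 ** A j)"
      using s by (auto simp: basis_traces_def)
    then show ?thesis
    proof cases
      case 4
      then have "A j = P (v (tr_on_tuples k (\<lambda>A. A j))) (v (tr_on_tuples k (\<lambda>A. A 1 ** A j)))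
        (v (tr_on_tuples k (\<lambda>A. A 2 ** A j)))"
        by (simp add: A_def)
      then have "trace (A j) = v (tr_on_tuples k (\<lambda>A. A j))"
        "trace (A 1 ** A j) = v (tr_on_tuples k (\<lambda>A. A 1 ** A j))"
        "trace (A 2 ** A j) = v (tr_on_tuples k (\<lambda>A. A 2 ** A j))"
        using P by (simp_all add: A12)
      with 4(2) A show ?thesis by (auto simp: tr_on_tuples_def)
    qed (use A A12 MN in \<open>auto simp: tr_on_tuples_def x_def y_def z_def\<close>)
  qed
  with A show ?thesis by blast
qed

text \<open>Both conditions are monic quadratic equations in \<open>z\<close>.\<close>

lemma generic_values:
  fixes x y :: "'a::field"
  shows "finite {z. z * z = 4 \<or> disc x y z = 0}"
proof -
  have "{z. z * z = 4 \<or> disc x y z = 0} =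
    {z. poly [:-4, 0, 1:] z = 0} \<union> {z. poly [:x * x + y * y - 4, - x * y, 1:] z = 0}"
    by (auto simp: disc_def algebra_simps)
  also have "finite \<dots>" by (intro finite_UnI poly_roots_finite) auto
  finally show ?thesis .
qed

lemma basis_traces_independent:
  assumes k: "k \<ge> 2"
  shows "algebraically_independent (coord_ring k :: ((nat \<Rightarrow> 'a::alg_closed_field ^ 2 ^ 2) \<Rightarrow> 'a) ring)
    (constants k) (basis_traces k)"
proof (rule algebraically_independent_if_generic[OF infinite_alg_closed_field finite_basis_traces
      basis_traces_in_coord_ring[OF k], where z = "tr_on_tuples k (\<lambda>A. A 1 ** A 2)"])
  fix v :: "((nat \<Rightarrow> 'a ^ 2 ^ 2) \<Rightarrow> 'a) \<Rightarrow> 'a"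
  let ?x = "tr_on_tuples k (\<lambda>A. A 1) :: (nat \<Rightarrow> 'a ^ 2 ^ 2) \<Rightarrow> 'a"
  let ?y = "tr_on_tuples k (\<lambda>A. A 2) :: (nat \<Rightarrow> 'a ^ 2 ^ 2) \<Rightarrow> 'a"
  let ?z = "tr_on_tuples k (\<lambda>A. A 1 ** A 2) :: (nat \<Rightarrow> 'a ^ 2 ^ 2) \<Rightarrow> 'a"
  \<comment> \<open>A pair with traces 0, 0, 1 separates the function \<open>?z\<close> from
    \<open>?x\<close> and \<open>?y\<close>, so that updating \<open>v\<close> at \<open>?z\<close>
    leaves its values at the other two unchanged.\<close>
  obtain M N :: "'a ^ 2 ^ 2" where MN: "det M = 1" "det N = 1" "trace M = 0" "trace N = 0" "trace (M ** N) = 1"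
    using exists_SL2_traces[of 0 0 1] by blast
  define A where "A = (\<lambda>i\<in>{1..k}. if i = 1 then M else N)"
  have "A \<in> SL2_tuples k" using MN by (auto simp: SL2_tuples_def A_def)
  then have "?x A = 0" "?y A = 0" "?z A = 1"
    using MN k by (auto simp: tr_on_tuples_def A_def)
  then have distinct: "?x \<noteq> ?z" "?y \<noteq> ?z" by (metis zero_neq_one)+
  let ?B = "{z. z * z = 4 \<or> disc (v ?x) (v ?y) z = 0}"
  have "\<exists>A\<in>SL2_tuples k. \<forall>s\<in>basis_traces k. s A = (v(?z := t)) s" if "t \<notin> ?B" for t
    using basis_traces_generic[OF k, of "v(?z := t)"] that distinct by simp
  then show "\<exists>B. finite B \<and> (\<forall>t. t \<notin> B \<longrightarrow>
      (\<exists>A\<in>SL2_tuples k. \<forall>s\<in>basis_traces k. s A = (v(?z := t)) s))"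
    using generic_values by (intro exI[of _ ?B]) blast
qed

text \<open>It suffices that every word is \<open>good\<close> for the algebraic elements.
  Generators are, inverses follow by the adjugate, and concatenation preserves the property once the
  discriminant is cancelled.\<close>

lemma coord_ring_algebraic:
  assumes k: "k \<ge> 2"
  shows "carrier (coord_ring k) \<subseteq> domain_with_generators.alg
    (coord_ring k :: ((nat \<Rightarrow> 'a::alg_closed_field ^ 2 ^ 2) \<Rightarrow> 'a) ring) (constants k \<union> basis_traces k)"
proof -
  let ?R = "coord_ring k :: ((nat \<Rightarrow> 'a ^ 2 ^ 2) \<Rightarrow> 'a) ring"
  interpret domain ?R by (rule domain_coord_ring)
  interpret D: domain_with_generators ?R "constants k \<union> basis_traces k"
    by unfold_locales (use constants_in_coord_ring basis_traces_in_coord_ring[OF k] in blast)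
  interpret Rat: function_algebra k D.rat
  proof
    show "(\<lambda>A\<in>SL2_tuples k. c) \<in> D.rat" for c
      by (rule D.rat_incl) (auto simp: constants_def)
  qed (use D.rat_closed in \<open>simp_all add: coord_ring_simps\<close>)
  interpret Alg: function_algebra k D.alg
  proof
    show "(\<lambda>A\<in>SL2_tuples k. c) \<in> D.alg" for c
      using Rat.const D.rat_sub_alg by blast
  qed (use D.alg_closed_add D.alg_closed_mult in \<open>simp_all add: coord_ring_simps\<close>)
  have Alg: "Alg.mem f" if "Rat.mem f" for f
    using that D.rat_sub_alg by (auto simp: Alg.mem_def Rat.mem_def)
  have rat: "Rat.mem (\<lambda>A. trace (M A))" if "tr_on_tuples k M \<in> basis_traces k" for M
    unfolding Rat.mem_tr_on_tuples using that by (intro D.rat_incl) blast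
  have rat12: "Rat.mem (\<lambda>A. trace (A 1))" "Rat.mem (\<lambda>A. trace (A 2))" "Rat.mem (\<lambda>A. trace (A 1 ** A 2))"
    by (rule rat, simp add: basis_traces_def)+
  have rat3: "Rat.mem (\<lambda>A. trace (A j))" "Rat.mem (\<lambda>A. trace (A 1 ** A j))" "Rat.mem (\<lambda>A. trace (A 2 ** A j))"
    if "j \<in> {3..k}" for j
    by (rule rat, use that in \<open>force simp: basis_traces_def\<close>)+
  note alg12 = rat12[THEN Alg] and alg3 = rat3[THEN Alg]
  have in_R: "(\<lambda>A\<in>SL2_tuples k. trace (rep A w)) \<in> carrier ?R" if "set w \<subseteq> {1..k} \<times> UNIV" for w
    by (rule trace_rep_in_coord_ring[OF that])
  let ?disc = "\<lambda>A :: nat \<Rightarrow> 'a ^ 2 ^ 2. disc (trace (A 1)) (trace (A 2)) (trace (A 1 ** A 2))"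
  have disc_alg: "Alg.mem ?disc"
    unfolding disc_def by (intro Alg.mem_intros alg12)
  have disc_nonzero: "restrict ?disc (SL2_tuples k) \<noteq> \<zero>\<^bsub>?R\<^esub>"
  proof
    assume 0: "restrict ?disc (SL2_tuples k) = \<zero>\<^bsub>?R\<^esub>"
    obtain z :: 'a where z: "disc 0 0 z \<noteq> 0"
      using generic_values[of 0 "0::'a"] infinite_alg_closed_field
      by (metis (mono_tags, lifting) finite_subset mem_Collect_eq subsetI)
    obtain M N :: "'a ^ 2 ^ 2" where MN: "det M = 1" "det N = 1" "trace M = 0" "trace N = 0" "trace (M ** N) = z"
      using exists_SL2_traces[of 0 0 z] by blast
    define A where "A = (\<lambda>i\<in>{1..k}. if i = 1 then M else N)"
    have "A \<in> SL2_tuples k" using MN by (auto simp: SL2_tuples_def A_def)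
    moreover have "A 1 = M" "A 2 = N" using k by (auto simp: A_def)
    ultimately show False using fun_cong[OF 0, of A] z MN by (simp add: coord_ring_simps)
  qed
  have cancel: "Alg.mem (\<lambda>A. trace (rep A w))"
    if "Alg.mem (\<lambda>A. ?disc A * trace (rep A w))" "set w \<subseteq> {1..k} \<times> UNIV" for w
    unfolding Alg.mem_def
  proof (rule D.alg_cancel[OF disc_alg[unfolded Alg.mem_def] disc_nonzero in_R[OF that(2)]])
    show "restrict ?disc (SL2_tuples k) \<otimes>\<^bsub>?R\<^esub> (\<lambda>A\<in>SL2_tuples k. trace (rep A w)) \<in> D.alg"
      using that(1) by (simp add: Alg.mem_def coord_ring_simps cong: restrict_cong)
  qed
  have trace_append: "Alg.mem (\<lambda>A. trace (rep A (u @ v)))"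
    if "Alg.good (\<lambda>A. rep A u)" "Alg.good (\<lambda>A. rep A v)" "set (u @ v) \<subseteq> {1..k} \<times> UNIV" for u v
    using Alg.good_mult_disc[OF k alg12 that(1,2)] by (intro cancel that) (simp add: rep_append)
  have good_append: "Alg.good (\<lambda>A. rep A (u @ v))"
    if u: "Alg.good (\<lambda>A. rep A u)" and v: "Alg.good (\<lambda>A. rep A v)" and uv: "set (u @ v) \<subseteq> {1..k} \<times> UNIV" for u v
  proof -
    \<comment> \<open>Basis matrices standing in front are absorbed into \<open>u\<close>, so each
      of the four required traces is again the trace of a concatenation of two good words.\<close>
    let ?a = "(1, True)" and ?b = "(2, True)"
    have left: "Alg.good (\<lambda>A. rep A (?a # w))" "Alg.good (\<lambda>A. rep A (?b # w))" if "Alg.good (\<lambda>A. rep A w)" for w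
      using Alg.good_left[OF k alg12 that] by (simp_all add: rep_Cons letter_value_def)
    note t = trace_append[OF _ v]
    show ?thesis
      using t[OF u] t[OF left(1)[OF u]] t[OF left(2)[OF u]] t[OF left(1)[OF left(2)[OF u]]] uv k
      by (auto simp: Alg.good_def rep_Cons letter_value_def matrix_mul_assoc)
  qed
  have good_gen: "Alg.good (\<lambda>A. A i)" if i: "i \<in> {1..k}" for i
  proof -
    consider "i = 1" | "i = 2" | "i \<in> {3..k}" using i by fastforce
    then show ?thesis
    proof cases
      case 3
      \<comment> \<open>The other three traces of \<open>A i\<close> belong to the proposed basis;
        this one is a root of the Fricke quadratic over them.\<close>
      have "Alg.mem (\<lambda>A. trace (A 1 ** A 2 ** A i))"
        unfolding Alg.mem_def
      proof (rule D.alg_quadratic)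
        let ?p = "\<lambda>A :: nat \<Rightarrow> 'a ^ 2 ^ 2. - (trace (A 1) * trace (A 2 ** A i) + trace (A 2) * trace (A 1 ** A i)
          + (trace (A 1 ** A 2) - trace (A 1) * trace (A 2)) * trace (A i))"
        let ?q = "\<lambda>A :: nat \<Rightarrow> 'a ^ 2 ^ 2. trace (A 1) * trace (A 1) + trace (A 2) * trace (A 2) + trace (A i) * trace (A i)
          + trace (A 1 ** A 2) * trace (A 1 ** A 2) + trace (A 1 ** A i) * trace (A 1 ** A i)
          + trace (A 2 ** A i) * trace (A 2 ** A i)
          - trace (A 1) * trace (A 2) * trace (A 1 ** A 2) - trace (A 2) * trace (A i) * trace (A 2 ** A i)
          - trace (A 1) * trace (A i) * trace (A 1 ** A i)
          + trace (A 1 ** A 2) * trace (A 1 ** A i) * trace (A 2 ** A i) - 4"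
        let ?d = "\<lambda>A\<in>SL2_tuples k. trace (A 1 ** A 2 ** A i) :: 'a"
        show "restrict ?p (SL2_tuples k) \<in> D.rat"
          unfolding Rat.mem_def[symmetric] by (intro Rat.mem_intros rat12 rat3 3)
        show "restrict ?q (SL2_tuples k) \<in> D.rat"
          unfolding Rat.mem_def[symmetric] by (intro Rat.mem_intros rat12 rat3 3)
        show "?d \<in> carrier ?R"
          using in_R[of "[(1, True), (2, True), (i, True)]"] i k
          by (simp add: rep_Cons letter_value_def rep_def matrix_mul_assoc)
        have "?d A * ?d A + restrict ?p (SL2_tuples k) A * ?d A + restrict ?q (SL2_tuples k) A = 0"
          if A: "A \<in> SL2_tuples k" for A
          using fricke_quadratic[of "A 1" "A 2" "A i"] SL2_tuplesD[OF A] k i A by simp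
        then show "?d \<otimes>\<^bsub>?R\<^esub> ?d \<oplus>\<^bsub>?R\<^esub> restrict ?p (SL2_tuples k) \<otimes>\<^bsub>?R\<^esub> ?d
            \<oplus>\<^bsub>?R\<^esub> restrict ?q (SL2_tuples k) = \<zero>\<^bsub>?R\<^esub>"
          unfolding coord_ring_simps by (intro restrict_ext) simp
      qed
      then show ?thesis using alg3[OF 3] by (simp add: Alg.good_def)
    qed (use Alg.good_left[OF k alg12 Alg.good_one[OF k alg12]] in simp_all)
  qed
  have good_letter: "Alg.good (\<lambda>A. rep A [a])" if a: "fst a \<in> {1..k}" for a
  proof (cases "snd a")
    case True
    then show ?thesis using good_gen[OF a] by (simp add: rep_def letter_value_def)
  next
    case False
    then show ?thesis
      using Alg.good_adjugate[OF good_gen[OF a] Alg.good_one[OF k alg12]] SL2_tuplesD[OF _ a, where ?'a = 'a]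
      by (subst Alg.good_cong) (auto simp: rep_def letter_value_def inv_SL2)
  qed
  have good: "Alg.good (\<lambda>A. rep A w)" if "set w \<subseteq> {1..k} \<times> UNIV" for w
    using that
  proof (induction w)
    case Nil
    then show ?case using Alg.good_one[OF k alg12] by (simp add: rep_def)
  next
    case (Cons a w)
    then show ?case using good_append[of "[a]" w] good_letter[of a] by auto
  qed
  show ?thesis
  proof (rule coord_ring_least[OF Alg.function_algebra_axioms])
    fix w assume "w \<in> carrier (free_group k)"
    then have "set w \<subseteq> {1..k} \<times> UNIV" by (auto simp: free_group_def)
    from good[OF this] show "trace_fun k w \<in> D.alg"
      by (simp add: Alg.good_def Alg.mem_def trace_fun_def character_def)
  qed
qed

lemma transcendental_generators_basis_traces:
  assumes k: "k \<ge> 2"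
  shows "transcendental_generators (coord_ring k :: ((nat \<Rightarrow> 'a::alg_closed_field ^ 2 ^ 2) \<Rightarrow> 'a) ring)
    (constants k) (basis_traces k)"
proof -
  let ?R = "coord_ring k :: ((nat \<Rightarrow> 'a ^ 2 ^ 2) \<Rightarrow> 'a) ring"
  interpret domain ?R by (rule domain_coord_ring)
  interpret D: domain_with_generators ?R "constants k \<union> basis_traces k"
    by unfold_locales (use constants_in_coord_ring basis_traces_in_coord_ring[OF k] in blast)
  show ?thesis
    unfolding transcendental_generators_def
    using basis_traces_in_coord_ring[OF k] basis_traces_independent[OF k] coord_ring_algebraic[OF k]
    by (auto simp: D.alg_def D.E_def D.emb_def[abs_def])
qed

end

theorem corollary5p4:
  fixes k :: nat
  assumes "k \<ge> 2"
  shows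
    "(CHAR('a::alg_closed_field) \<noteq> 2 \<or> k \<le> 3 \<longrightarrow>
       generated_algebra (coord_ring k :: ((nat \<Rightarrow> 'a ^ 2 ^ 2) \<Rightarrow> 'a) ring) (constants k)
         ({tr_on_tuples k (\<lambda>A. A i) | i. i \<in> {1..k}} \<union>
          {tr_on_tuples k (\<lambda>A. A i ** A j) | i j. i \<in> {1..k} \<and> j \<in> {1..k} \<and> i < j} \<union>
          {tr_on_tuples k (\<lambda>A. A i ** A j ** A l) | i j l.
             i \<in> {1..k} \<and> j \<in> {1..k} \<and> l \<in> {1..k} \<and> i < j \<and> j < l})
       = carrier (coord_ring k)) \<and>
     transcendental_generators (coord_ring k :: ((nat \<Rightarrow> 'a ^ 2 ^ 2) \<Rightarrow> 'a) ring) (constants k)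
       ({tr_on_tuples k (\<lambda>A. A 1), tr_on_tuples k (\<lambda>A. A 2), tr_on_tuples k (\<lambda>A. A 1 ** A 2)} \<union>
        (\<Union>j\<in>{3..k}. {tr_on_tuples k (\<lambda>A. A j), tr_on_tuples k (\<lambda>A. A 1 ** A j),
                      tr_on_tuples k (\<lambda>A. A 2 ** A j)}))"
  using trace_generators transcendental_generators_basis_traces[OF assms, unfolded basis_traces_def]
  by blast

end
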